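(* Let $R$ be a Gorenstein ring and let $M$ be a complex of $R$-modules. For each complex $N$ of $R$-modules there is a long exact sequence $$\cdots\to \mathrm{Ext}_R^{n-1}(M,N)\to \overline{\mathrm{Ext}}^{\,n-1}(M,N)\to \mathrm{Ext}^n_{\mathcal G}(M,N)\to \mathrm{Ext}^n_R(M,N)\to \overline{\mathrm{Ext}}^{\,n}(M,N)\to\cdots$$
   Context: A ring is Gorenstein if it is left and right noetherian and has finite self-injective dimension on both sides. "$R$-module" means left $R$-module. Complexes are chain complexes. For complexes $X,Y$, $\mathcal{H}om(X,Y)$ is the complex with $\mathcal{H}om(X,Y)_n=\prod_{q=p+n}\mathrm{Hom}_R(X_p,Y_q)$ and $\partial(f)=\partial^Y f-(-1)^n f\partial^X$ for $f$ of degree $n$; $H^n\mathcal{H}om(X,Y)=H_{-n}\mathcal{H}om(X,Y)$. $\mathrm{Hom}(X,Y)$ is the group of maps of complexes from $X$ to $Y$. A complex $P$ is DG-projective if each $P_n$ is projective and $\mathcal{H}om(P,E)$ is exact for every exact complex $E$; a DG-projective resolution of $M$ is a quasi-isomorphism $P\to M$ with $P$ DG-projective. A complex is projective if it is exact with all terms and all kernels of differentials projective modules. A complex has finite projective dimension if it has a finite resolution $0\to Q_n\to\cdots\to Q_0\to L\to 0$ (exact sequence of complexes) by projective complexes $Q_j$. A complex $G$ is Gorenstein projective if there is an exact sequence of complexes $\cdots\to Q_1\to Q_0\to Q_{-1}\to\cdots$ with each $Q_i$ a projective complex, which stays exact under $\mathrm{Hom}(-,Q)$ for every projective complex $Q$,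 with $G=\mathrm{Ker}(Q_0\to Q_{-1})$. A Gorenstein projective precover of $M$ is a map of complexes $\phi: G\to M$ with $G$ Gorenstein projective such that $\mathrm{Hom}(G',G)\to\mathrm{Hom}(G',M)$ is surjective for every Gorenstein projective complex $G'$; it is special if $\mathrm{Ker}\,\phi$ has finite projective dimension. Over a Gorenstein ring every complex has a special Gorenstein projective precover. Let $P\to M$ be a surjective DG-projective resolution, $G\to M$ a special Gorenstein projective precover, and $u:P\to G$ a map of complexes over $M$ (i.e. induced by $1_M$). Let $M(u)$ be the mapping cone, $M(u)_n=G_n\oplus P_{n-1}$ with differential $(x,y)\mapsto(\partial^G x+u(y),-\partial^P y)$. Define - absolute cohomology: $\mathrm{Ext}^n_R(M,N)=H^n\mathcal{H}om(P,N)$; - Gorenstein cohomology: $\mathrm{Ext}^n_{\mathcal G}(M,N)=H^n\mathcal{H}om(G,N)$; - generalized Tate cohomology: $\overline{\mathrm{Ext}}^{\,n}(M,N)=H^{n+1}\mathcal{H}om(M(u),N)$. These are independent of the choices, up to isomorphism. *)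

theory Defs
  imports "HOL-Algebra.AbelCoset" "HOL-Algebra.Module" "HOL-Library.Equipollence"
begin

text \<open>
  \<^bold>\<open>Universes.\<close>  The modules of a statement are carried by subsets of one type \<open>'m\<close>, and
  every quantification over all modules or all complexes ranges over those carried by
  \<open>'m\<close>.  If \<open>'m\<close> is infinite and the ring injects into it, each module of cardinality at most
  that of \<open>'m\<close> has an isomorphic copy there, in particular the free module on the elements of
  any module carried by \<open>'m\<close>.  Over a Gorenstein ring the notions below then agree with
  those quantifying over all modules (for DG-projectivity: every chain map from a complex
  carried by \<open>'m\<close> to an exact complex has its image in an exact subcomplex with a copy
  carried by \<open>'m\<close>).
\<close>

section \<open>Left modules\<close>

text \<open>
  The library locale \<^locale>\<open>module\<close> requires a commutative ring.  The record type is
  reused; as there, the fields for multiplication and unit of a module are irrelevant.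
\<close>

locale left_module = R?: ring R + M?: abelian_group M
  for R :: "'r ring" (structure) and M :: "('r, 'm) module" (structure) +
  assumes smult_closed: "\<lbrakk>a \<in> carrier R; x \<in> carrier M\<rbrakk> \<Longrightarrow> a \<odot>\<^bsub>M\<^esub> x \<in> carrier M"
    and smult_l_distr: "\<lbrakk>a \<in> carrier R; b \<in> carrier R; x \<in> carrier M\<rbrakk>
      \<Longrightarrow> (a \<oplus> b) \<odot>\<^bsub>M\<^esub> x = a \<odot>\<^bsub>M\<^esub> x \<oplus>\<^bsub>M\<^esub> b \<odot>\<^bsub>M\<^esub> x"
    and smult_r_distr: "\<lbrakk>a \<in> carrier R; x \<in> carrier M; y \<in> carrier M\<rbrakk>
      \<Longrightarrow> a \<odot>\<^bsub>M\<^esub> (x \<oplus>\<^bsub>M\<^esub> y) = a \<odot>\<^bsub>M\<^esub> x \<oplus>\<^bsub>M\<^esub> a \<odot>\<^bsub>M\<^esub> y"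
    and smult_assoc1: "\<lbrakk>a \<in> carrier R; b \<in> carrier R; x \<in> carrier M\<rbrakk>
      \<Longrightarrow> (a \<otimes> b) \<odot>\<^bsub>M\<^esub> x = a \<odot>\<^bsub>M\<^esub> (b \<odot>\<^bsub>M\<^esub> x)"
    and smult_one: "x \<in> carrier M \<Longrightarrow> \<one> \<odot>\<^bsub>M\<^esub> x = x"

definition lmod_hom :: "'r ring \<Rightarrow> ('r, 'a) module \<Rightarrow> ('r, 'b) module \<Rightarrow> ('a \<Rightarrow> 'b) set"
  where "lmod_hom R A B = {f \<in> hom (add_monoid A) (add_monoid B).
    \<forall>r\<in>carrier R. \<forall>x\<in>carrier A. f (r \<odot>\<^bsub>A\<^esub> x) = r \<odot>\<^bsub>B\<^esub> f x}"

definition exact_at ::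
    "('r, 'a) module \<Rightarrow> ('a \<Rightarrow> 'b) \<Rightarrow> ('r, 'b) module \<Rightarrow> ('b \<Rightarrow> 'c) \<Rightarrow> ('r, 'c) module \<Rightarrow> bool"
  where "exact_at A f B g C \<longleftrightarrow> f ` carrier A = a_kernel B C g"

definition projective_module :: "'r ring \<Rightarrow> ('r, 'm) module \<Rightarrow> bool"
  where "projective_module R P \<longleftrightarrow> left_module R P \<and>
    (\<forall>(A :: ('r, 'm) module) (B :: ('r, 'm) module) e f.
       left_module R A \<and> left_module R B \<and>
       e \<in> lmod_hom R A B \<and> e ` carrier A = carrier B \<and> f \<in> lmod_hom R P B \<longrightarrow>
       (\<exists>h\<in>lmod_hom R P A. \<forall>x\<in>carrier P. e (h x) = f x))"

definition injective_module :: "'r ring \<Rightarrow> ('r, 'i) module \<Rightarrow> bool"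
  where "injective_module R I \<longleftrightarrow> left_module R I \<and>
    (\<forall>(A :: ('r, 'i) module) (B :: ('r, 'i) module) e f.
       left_module R A \<and> left_module R B \<and>
       e \<in> lmod_hom R A B \<and> inj_on e (carrier A) \<and> f \<in> lmod_hom R A I \<longrightarrow>
       (\<exists>h\<in>lmod_hom R B I. \<forall>x\<in>carrier A. h (e x) = f x))"


section \<open>Gorenstein rings\<close>

definition opposite_ring :: "'r ring \<Rightarrow> 'r ring"
  where "opposite_ring R = R\<lparr>mult := \<lambda>x y. y \<otimes>\<^bsub>R\<^esub> x\<rparr>"

definition regular_module :: "'r ring \<Rightarrow> ('r, 'r) module"
  where "regular_module R = \<lparr>carrier = carrier R, mult = mult R, one = \<one>\<^bsub>R\<^esub>,
    zero = \<zero>\<^bsub>R\<^esub>, add = add R, smult = mult R\<rparr>"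

definition left_ideal :: "'r ring \<Rightarrow> 'r set \<Rightarrow> bool"
  where "left_ideal R I \<longleftrightarrow> additive_subgroup I R \<and>
    (\<forall>r\<in>carrier R. \<forall>x\<in>I. r \<otimes>\<^bsub>R\<^esub> x \<in> I)"

definition left_noetherian :: "'r ring \<Rightarrow> bool"
  where "left_noetherian R \<longleftrightarrow> ring R \<and>
    (\<forall>I. left_ideal R I \<longrightarrow>
      (\<exists>A\<subseteq>carrier R. finite A \<and> I = \<Inter>{J. left_ideal R J \<and> A \<subseteq> J}))"

text \<open>
  An injective resolution \<open>0 \<rightarrow> R \<rightarrow> I\<^sub>0 \<rightarrow> \<dots> \<rightarrow> I\<^sub>k \<rightarrow> 0\<close> of \<open>R\<close> as a left module
  over itself, extended by zero modules.  If \<open>\<kappa>\<close> is the cardinality of \<open>'r list\<close>, every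
  module of cardinality at most \<open>2\<^sup>\<kappa>\<close> embeds in an injective module of cardinality at most
  \<open>2\<^sup>\<kappa>\<close>, so it is no restriction to take \<open>'r list set\<close> to carry the modules \<open>I\<^sub>j\<close>.
\<close>

definition finite_left_self_injective_dim :: "'r ring \<Rightarrow> bool"
  where "finite_left_self_injective_dim R \<longleftrightarrow>
    (\<exists>(I :: nat \<Rightarrow> ('r, 'r list set) module) e d k.
       (\<forall>j. injective_module R (I j)) \<and>
       (\<forall>j>k. carrier (I j) = {\<zero>\<^bsub>I j\<^esub>}) \<and>
       e \<in> lmod_hom R (regular_module R) (I 0) \<and> inj_on e (carrier R) \<and>
       (\<forall>j. d j \<in> lmod_hom R (I j) (I (Suc j))) \<and>
       exact_at (regular_module R) e (I 0) (d 0) (I 1) \<and>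
       (\<forall>j. exact_at (I j) (d j) (I (Suc j)) (d (Suc j)) (I (Suc (Suc j)))))"

text \<open>Right modules are left modules over the opposite ring.\<close>

definition gorenstein_ring :: "'r ring \<Rightarrow> bool"
  where "gorenstein_ring R \<longleftrightarrow> ring R \<and>
    left_noetherian R \<and> left_noetherian (opposite_ring R) \<and>
    finite_left_self_injective_dim R \<and> finite_left_self_injective_dim (opposite_ring R)"


section \<open>Complexes of modules\<close>

record ('r, 'm) complex_of_modules =
  cobj :: "int \<Rightarrow> ('r, 'm) module"
  cdiff :: "int \<Rightarrow> 'm \<Rightarrow> 'm"

definition chain_complex :: "'r ring \<Rightarrow> ('r, 'm) complex_of_modules \<Rightarrow> bool"
  where "chain_complex R X \<longleftrightarrow>
    (\<forall>n. left_module R (cobj X n) \<and> cdiff X n \<in> lmod_hom R (cobj X n) (cobj X (n - 1)) \<and>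
      (\<forall>x\<in>carrier (cobj X n). cdiff X (n - 1) (cdiff X n x) = \<zero>\<^bsub>cobj X (n - 2)\<^esub>))"

definition chain_maps ::
    "'r ring \<Rightarrow> ('r, 'a) complex_of_modules \<Rightarrow> ('r, 'b) complex_of_modules \<Rightarrow> (int \<Rightarrow> 'a \<Rightarrow> 'b) set"
  where "chain_maps R X Y = {f. \<forall>n. f n \<in> lmod_hom R (cobj X n) (cobj Y n) \<and>
    (\<forall>x\<in>carrier (cobj X n). f (n - 1) (cdiff X n x) = cdiff Y n (f n x))}"

definition surjective_map ::
    "('r, 'a) complex_of_modules \<Rightarrow> ('r, 'b) complex_of_modules \<Rightarrow> (int \<Rightarrow> 'a \<Rightarrow> 'b) \<Rightarrow> bool"
  where "surjective_map X Y f \<longleftrightarrow> (\<forall>n. f n ` carrier (cobj X n) = carrier (cobj Y n))"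

definition complex_iso ::
    "'r ring \<Rightarrow> ('r, 'a) complex_of_modules \<Rightarrow> ('r, 'b) complex_of_modules \<Rightarrow> bool"
  where "complex_iso R X Y \<longleftrightarrow>
    (\<exists>f\<in>chain_maps R X Y. \<forall>n. bij_betw (f n) (carrier (cobj X n)) (carrier (cobj Y n)))"

definition ker_complex ::
    "('r, 'a) complex_of_modules \<Rightarrow> ('r, 'b) complex_of_modules \<Rightarrow> (int \<Rightarrow> 'a \<Rightarrow> 'b)
      \<Rightarrow> ('r, 'a) complex_of_modules"
  where "ker_complex X Y f =
    \<lparr>cobj = (\<lambda>n. (cobj X n)\<lparr>carrier := a_kernel (cobj X n) (cobj Y n) (f n)\<rparr>),
     cdiff = cdiff X\<rparr>"

definition exact_at_complex ::
    "('r, 'a) complex_of_modules \<Rightarrow> (int \<Rightarrow> 'a \<Rightarrow> 'b) \<Rightarrow> ('r, 'b) complex_of_modules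
      \<Rightarrow> (int \<Rightarrow> 'b \<Rightarrow> 'c) \<Rightarrow> ('r, 'c) complex_of_modules \<Rightarrow> bool"
  where "exact_at_complex X f Y g Z \<longleftrightarrow>
    (\<forall>n. exact_at (cobj X n) (f n) (cobj Y n) (g n) (cobj Z n))"

definition exact_complex :: "'r ring \<Rightarrow> ('r, 'm) complex_of_modules \<Rightarrow> bool"
  where "exact_complex R X \<longleftrightarrow> chain_complex R X \<and>
    (\<forall>n. exact_at (cobj X (n + 1)) (cdiff X (n + 1)) (cobj X n) (cdiff X n) (cobj X (n - 1)))"

text \<open>Homology at \<open>B\<close> of a sequence of abelian groups \<open>A \<rightarrow> B \<rightarrow> C\<close> with maps \<open>f\<close>, \<open>g\<close>
  such that \<open>g \<circ> f = 0\<close>.\<close>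

definition homology_at ::
    "('a, 'x) monoid_scheme \<Rightarrow> ('a \<Rightarrow> 'b) \<Rightarrow> ('b, 'y) monoid_scheme
      \<Rightarrow> ('b \<Rightarrow> 'c) \<Rightarrow> ('c, 'z) monoid_scheme \<Rightarrow> 'b set monoid"
  where "homology_at A f B g C = B\<lparr>carrier := kernel B C g\<rparr> Mod (f ` carrier A)"

definition homology :: "('r, 'm) complex_of_modules \<Rightarrow> int \<Rightarrow> 'm set monoid"
  where "homology X n = homology_at
    (add_monoid (cobj X (n + 1))) (cdiff X (n + 1))
    (add_monoid (cobj X n)) (cdiff X n) (add_monoid (cobj X (n - 1)))"

definition boundaries :: "('r, 'm) complex_of_modules \<Rightarrow> int \<Rightarrow> 'm set"
  where "boundaries X n = cdiff X (n + 1) ` carrier (cobj X (n + 1))"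

definition quasi_isomorphism ::
    "'r ring \<Rightarrow> ('r, 'a) complex_of_modules \<Rightarrow> ('r, 'b) complex_of_modules \<Rightarrow> (int \<Rightarrow> 'a \<Rightarrow> 'b) \<Rightarrow> bool"
  where "quasi_isomorphism R X Y f \<longleftrightarrow> f \<in> chain_maps R X Y \<and>
    (\<forall>n. \<exists>h\<in>iso (homology X n) (homology Y n).
      \<forall>x\<in>a_kernel (cobj X n) (cobj X (n - 1)) (cdiff X n).
        h (boundaries X n +>\<^bsub>cobj X n\<^esub> x) = boundaries Y n +>\<^bsub>cobj Y n\<^esub> f n x)"


section \<open>The Hom complex and the mapping cone\<close>

text \<open>
  An element of degree \<open>n\<close> is a family of homomorphisms \<open>f p\<close> from \<open>X\<^sub>p\<close> to \<open>Y\<^sub>p\<^sub>+\<^sub>n\<close>.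
  The maps are taken to be \<^const>\<open>undefined\<close> outside their domains, so that equality of
  elements is equality of homomorphisms.
\<close>

definition Hom_grp ::
    "'r ring \<Rightarrow> ('r, 'a) complex_of_modules \<Rightarrow> ('r, 'b) complex_of_modules \<Rightarrow> int
      \<Rightarrow> (int \<Rightarrow> 'a \<Rightarrow> 'b) monoid"
  where "Hom_grp R X Y n =
    \<lparr>carrier = {f. \<forall>p. f p \<in> lmod_hom R (cobj X p) (cobj Y (p + n)) \<inter> extensional (carrier (cobj X p))},
     mult = (\<lambda>f g p. \<lambda>x\<in>carrier (cobj X p). f p x \<oplus>\<^bsub>cobj Y (p + n)\<^esub> g p x),
     one = (\<lambda>p. \<lambda>x\<in>carrier (cobj X p). \<zero>\<^bsub>cobj Y (p + n)\<^esub>)\<rparr>"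

text \<open>The differential \<open>\<partial>\<^sup>Y f - (-1)\<^sup>n f \<partial>\<^sup>X\<close> from degree \<open>n\<close> to degree \<open>n - 1\<close>.\<close>

definition Hom_diff ::
    "('r, 'a) complex_of_modules \<Rightarrow> ('r, 'b) complex_of_modules \<Rightarrow> int
      \<Rightarrow> (int \<Rightarrow> 'a \<Rightarrow> 'b) \<Rightarrow> (int \<Rightarrow> 'a \<Rightarrow> 'b)"
  where "Hom_diff X Y n f = (\<lambda>p. \<lambda>x\<in>carrier (cobj X p).
    let Z = cobj Y (p + n - 1); a = cdiff Y (p + n) (f p x); b = f (p - 1) (cdiff X p x)
    in if even n then a \<ominus>\<^bsub>Z\<^esub> b else a \<oplus>\<^bsub>Z\<^esub> b)"

definition Hom_homology ::
    "'r ring \<Rightarrow> ('r, 'a) complex_of_modules \<Rightarrow> ('r, 'b) complex_of_modules \<Rightarrow> int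
      \<Rightarrow> (int \<Rightarrow> 'a \<Rightarrow> 'b) set monoid"
  where "Hom_homology R X Y n = homology_at
    (Hom_grp R X Y (n + 1)) (Hom_diff X Y (n + 1))
    (Hom_grp R X Y n) (Hom_diff X Y n) (Hom_grp R X Y (n - 1))"

definition Hom_cohomology ::
    "'r ring \<Rightarrow> ('r, 'a) complex_of_modules \<Rightarrow> ('r, 'b) complex_of_modules \<Rightarrow> int
      \<Rightarrow> (int \<Rightarrow> 'a \<Rightarrow> 'b) set monoid"
  where "Hom_cohomology R X Y n = Hom_homology R X Y (- n)"

definition Hom_exact ::
    "'r ring \<Rightarrow> ('r, 'a) complex_of_modules \<Rightarrow> ('r, 'b) complex_of_modules \<Rightarrow> bool"
  where "Hom_exact R X Y \<longleftrightarrow>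
    (\<forall>n. Hom_diff X Y (n + 1) ` carrier (Hom_grp R X Y (n + 1)) =
      kernel (Hom_grp R X Y n) (Hom_grp R X Y (n - 1)) (Hom_diff X Y n))"

definition direct_sum :: "('r, 'a) module \<Rightarrow> ('r, 'b) module \<Rightarrow> ('r, 'a \<times> 'b) module"
  where "direct_sum A B =
    \<lparr>carrier = carrier A \<times> carrier B,
     mult = (\<lambda>(a, b) (a', b'). (a \<otimes>\<^bsub>A\<^esub> a', b \<otimes>\<^bsub>B\<^esub> b')),
     one = (\<one>\<^bsub>A\<^esub>, \<one>\<^bsub>B\<^esub>),
     zero = (\<zero>\<^bsub>A\<^esub>, \<zero>\<^bsub>B\<^esub>),
     add = (\<lambda>(a, b) (a', b'). (a \<oplus>\<^bsub>A\<^esub> a', b \<oplus>\<^bsub>B\<^esub> b')),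
     smult = (\<lambda>r (a, b). (r \<odot>\<^bsub>A\<^esub> a, r \<odot>\<^bsub>B\<^esub> b))\<rparr>"

definition mapping_cone ::
    "('r, 'b) complex_of_modules \<Rightarrow> ('r, 'a) complex_of_modules \<Rightarrow> (int \<Rightarrow> 'b \<Rightarrow> 'a)
      \<Rightarrow> ('r, 'a \<times> 'b) complex_of_modules"
  where "mapping_cone P G u =
    \<lparr>cobj = (\<lambda>n. direct_sum (cobj G n) (cobj P (n - 1))),
     cdiff = (\<lambda>n (x, y). (cdiff G n x \<oplus>\<^bsub>cobj G (n - 1)\<^esub> u (n - 1) y,
                          \<ominus>\<^bsub>cobj P (n - 2)\<^esub> cdiff P (n - 1) y))\<rparr>"


section \<open>DG-projective resolutions and Gorenstein projective precovers\<close>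

definition DG_projective :: "'r ring \<Rightarrow> ('r, 'm) complex_of_modules \<Rightarrow> bool"
  where "DG_projective R P \<longleftrightarrow> chain_complex R P \<and>
    (\<forall>n. projective_module R (cobj P n)) \<and>
    (\<forall>E :: ('r, 'm) complex_of_modules. exact_complex R E \<longrightarrow> Hom_exact R P E)"

definition DG_projective_resolution ::
    "'r ring \<Rightarrow> ('r, 'm) complex_of_modules \<Rightarrow> ('r, 'm) complex_of_modules
      \<Rightarrow> (int \<Rightarrow> 'm \<Rightarrow> 'm) \<Rightarrow> bool"
  where "DG_projective_resolution R P M \<pi> \<longleftrightarrow> DG_projective R P \<and> quasi_isomorphism R P M \<pi>"

definition projective_complex :: "'r ring \<Rightarrow> ('r, 'm) complex_of_modules \<Rightarrow> bool"
  where "projective_complex R Q \<longleftrightarrow> exact_complex R Q \<and>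
    (\<forall>n. projective_module R (cobj Q n) \<and>
      projective_module R
        ((cobj Q n)\<lparr>carrier := a_kernel (cobj Q n) (cobj Q (n - 1)) (cdiff Q n)\<rparr>))"

text \<open>The finite resolution \<open>0 \<rightarrow> Q\<^sub>k \<rightarrow> \<dots> \<rightarrow> Q\<^sub>0 \<rightarrow> L \<rightarrow> 0\<close> is extended by zero complexes.\<close>

definition finite_projective_dim :: "'r ring \<Rightarrow> ('r, 'm) complex_of_modules \<Rightarrow> bool"
  where "finite_projective_dim R L \<longleftrightarrow> chain_complex R L \<and>
    (\<exists>(Q :: nat \<Rightarrow> ('r, 'm) complex_of_modules) d e k.
       (\<forall>j. projective_complex R (Q j)) \<and>
       (\<forall>j>k. \<forall>n. carrier (cobj (Q j) n) = {\<zero>\<^bsub>cobj (Q j) n\<^esub>}) \<and>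
       e \<in> chain_maps R (Q 0) L \<and> surjective_map (Q 0) L e \<and>
       (\<forall>j. d j \<in> chain_maps R (Q (Suc j)) (Q j)) \<and>
       exact_at_complex (Q 1) (d 0) (Q 0) e L \<and>
       (\<forall>j. exact_at_complex (Q (Suc (Suc j))) (d (Suc j)) (Q (Suc j)) (d j) (Q j)))"

text \<open>
  As usual, \<open>G = Ker(Q\<^sub>0 \<rightarrow> Q\<^sub>-\<^sub>1)\<close> is read up to isomorphism.  The third clause is exactness of
  \<open>Hom(Q\<^sub>i\<^sub>-\<^sub>1, T) \<rightarrow> Hom(Q\<^sub>i, T) \<rightarrow> Hom(Q\<^sub>i\<^sub>+\<^sub>1, T)\<close>; the composite vanishes because
  the composite of consecutive maps \<open>d\<close> does.
\<close>

definition gorenstein_projective :: "'r ring \<Rightarrow> ('r, 'm) complex_of_modules \<Rightarrow> bool"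
  where "gorenstein_projective R G \<longleftrightarrow> chain_complex R G \<and>
    (\<exists>(Q :: int \<Rightarrow> ('r, 'm) complex_of_modules) d.
       (\<forall>i. projective_complex R (Q i) \<and> d i \<in> chain_maps R (Q i) (Q (i - 1))) \<and>
       (\<forall>i. exact_at_complex (Q (i + 1)) (d (i + 1)) (Q i) (d i) (Q (i - 1))) \<and>
       (\<forall>(T :: ('r, 'm) complex_of_modules) i. projective_complex R T \<longrightarrow>
          (\<forall>f\<in>chain_maps R (Q i) T.
             (\<forall>n. \<forall>x\<in>carrier (cobj (Q (i + 1)) n). f n (d (i + 1) n x) = \<zero>\<^bsub>cobj T n\<^esub>) \<longrightarrow>
             (\<exists>h\<in>chain_maps R (Q (i - 1)) T.
                \<forall>n. \<forall>x\<in>carrier (cobj (Q i) n). f n x = h n (d i n x)))) \<and>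
       complex_iso R G (ker_complex (Q 0) (Q (- 1)) (d 0)))"

definition gorenstein_projective_precover ::
    "'r ring \<Rightarrow> ('r, 'm) complex_of_modules \<Rightarrow> ('r, 'm) complex_of_modules
      \<Rightarrow> (int \<Rightarrow> 'm \<Rightarrow> 'm) \<Rightarrow> bool"
  where "gorenstein_projective_precover R G M \<phi> \<longleftrightarrow>
    gorenstein_projective R G \<and> \<phi> \<in> chain_maps R G M \<and>
    (\<forall>G' :: ('r, 'm) complex_of_modules. gorenstein_projective R G' \<longrightarrow>
      (\<forall>f\<in>chain_maps R G' M. \<exists>h\<in>chain_maps R G' G.
         \<forall>n. \<forall>x\<in>carrier (cobj G' n). \<phi> n (h n x) = f n x))"

definition special_gorenstein_projective_precover ::
    "'r ring \<Rightarrow> ('r, 'm) complex_of_modules \<Rightarrow> ('r, 'm) complex_of_modules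
      \<Rightarrow> (int \<Rightarrow> 'm \<Rightarrow> 'm) \<Rightarrow> bool"
  where "special_gorenstein_projective_precover R G M \<phi> \<longleftrightarrow>
    gorenstein_projective_precover R G M \<phi> \<and> finite_projective_dim R (ker_complex G M \<phi>)"


section \<open>The three cohomology theories\<close>

text \<open>
  Resolution data for \<open>M\<close>: a surjective DG-projective resolution \<open>\<pi> : P \<rightarrow> M\<close>, a special
  Gorenstein projective precover \<open>\<phi> : G \<rightarrow> M\<close>, and a map \<open>u : P \<rightarrow> G\<close> over \<open>M\<close>.
\<close>

definition resolution_data ::
    "'r ring \<Rightarrow> ('r, 'm) complex_of_modules
      \<Rightarrow> ('r, 'm) complex_of_modules \<Rightarrow> (int \<Rightarrow> 'm \<Rightarrow> 'm)
      \<Rightarrow> ('r, 'm) complex_of_modules \<Rightarrow> (int \<Rightarrow> 'm \<Rightarrow> 'm) \<Rightarrow> (int \<Rightarrow> 'm \<Rightarrow> 'm) \<Rightarrow> bool"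
  where "resolution_data R M P \<pi> G \<phi> u \<longleftrightarrow>
    DG_projective_resolution R P M \<pi> \<and> surjective_map P M \<pi> \<and>
    special_gorenstein_projective_precover R G M \<phi> \<and>
    u \<in> chain_maps R P G \<and> (\<forall>n. \<forall>x\<in>carrier (cobj P n). \<phi> n (u n x) = \<pi> n x)"

definition Ext_abs ::
    "'r ring \<Rightarrow> ('r, 'm) complex_of_modules \<Rightarrow> int \<Rightarrow> ('r, 'm) complex_of_modules
      \<Rightarrow> (int \<Rightarrow> 'm \<Rightarrow> 'm) set monoid"
  where "Ext_abs R P n N = Hom_cohomology R P N n"

definition Ext_gor ::
    "'r ring \<Rightarrow> ('r, 'm) complex_of_modules \<Rightarrow> int \<Rightarrow> ('r, 'm) complex_of_modules
      \<Rightarrow> (int \<Rightarrow> 'm \<Rightarrow> 'm) set monoid"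
  where "Ext_gor R G n N = Hom_cohomology R G N n"

definition Ext_tate ::
    "'r ring \<Rightarrow> ('r, 'm) complex_of_modules \<Rightarrow> ('r, 'm) complex_of_modules \<Rightarrow> (int \<Rightarrow> 'm \<Rightarrow> 'm)
      \<Rightarrow> int \<Rightarrow> ('r, 'm) complex_of_modules \<Rightarrow> (int \<Rightarrow> 'm \<times> 'm \<Rightarrow> 'm) set monoid"
  where "Ext_tate R P G u n N = Hom_cohomology R (mapping_cone P G u) N (n + 1)"

end

theory Submission
  imports Defs
begin

text \<open>
  The degreewise split sequence \<open>0 \<rightarrow> G \<rightarrow> M(u) \<rightarrow> P[-1] \<rightarrow> 0\<close> stays exact under \<open>Hom(-, N)\<close>,
  and the long exact homology sequence of the resulting short exact sequence of complexes of
  abelian groups is the asserted one.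
\<close>

section \<open>The long exact homology sequence of complexes of abelian groups\<close>

text \<open>Exactness under Hom rests on an explicit splitting: in each degree the cone is the
  direct sum of \<open>G\<close> and the shifted \<open>P\<close>, so a family of maps on the cone
  amounts to one family on \<open>G\<close> and one on \<open>P\<close>. This splitting does not
  respect the differentials, and its failure to do so produces the connecting map. Extending a cycle
  on \<open>G\<close> by zero on the \<open>P\<close> part and taking its boundary leaves, up to
  sign, its composite with \<open>u\<close>. So the map from Gorenstein to absolute cohomology is
  the expected one induced by \<open>u\<close>.

  \<open>R\<close> is not commutative, so the maps between two modules form only an abelian group.
  The diagram chases are therefore done for commutative groups in multiplicative notation, the form
  in which \<open>Hom_grp\<close> is given. The three complexes are carried by different types.

  Homology of Hom out of the shifted \<open>P\<close> in degree \<open>k\<close> is that of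
  \<open>Hom(P, N)\<close> in degree \<open>k + 1\<close>. The \<open>n + 1\<close> in the
  definition of \<open>Ext_tate\<close> absorbs this shift.\<close>

text \<open>Homomorphisms of quotients are obtained from additive relations, so that the connecting
  homomorphism does not require a choice of representatives.\<close>

lemma FactGroup_hom_of_relation:
  assumes "comm_group G" "comm_group H" and N: "subgroup N G" and L: "subgroup L H"
    and carr: "\<And>x y. r x y \<Longrightarrow> x \<in> carrier G \<and> y \<in> carrier H"
    and total: "\<And>x. x \<in> carrier G \<Longrightarrow> \<exists>y. r x y"
    and mult: "\<And>x y x' y'. r x y \<Longrightarrow> r x' y' \<Longrightarrow> r (x \<otimes>\<^bsub>G\<^esub> x') (y \<otimes>\<^bsub>H\<^esub> y')"
    and null: "\<And>x y. r x y \<Longrightarrow> x \<in> N \<Longrightarrow> y \<in> L"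
  obtains h where "h \<in> hom (G Mod N) (H Mod L)"
    and "\<And>x y. r x y \<Longrightarrow> h (N #>\<^bsub>G\<^esub> x) = L #>\<^bsub>H\<^esub> y"
proof -
  interpret G: comm_group G by fact
  interpret H: comm_group H by fact
  interpret L: normal L H using L by (rule H.subgroup_imp_normal)
  have coset_eq: "L #>\<^bsub>H\<^esub> y = L #>\<^bsub>H\<^esub> y'"
    if r: "r x y" "r x' y'" and eq: "N #>\<^bsub>G\<^esub> x = N #>\<^bsub>G\<^esub> x'" for x x' y y'
  proof -
    have x: "x \<in> carrier G" "x' \<in> carrier G" and y: "y \<in> carrier H" "y' \<in> carrier H"
      using carr r by auto
    have "x \<in> N #>\<^bsub>G\<^esub> x'"
      using eq G.rcos_self[OF x(1) N] by simp
    then have 1: "x \<otimes>\<^bsub>G\<^esub> inv\<^bsub>G\<^esub> x' \<in> N"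
      using subgroup.rcos_module_imp[OF N] x G.is_group by blast
    \<comment> \<open>\<open>r\<close> is not assumed to respect inverses, so \<open>y\<close> and
      \<open>y'\<close> are compared through a value \<open>z\<close> of the inverse of
      \<open>x'\<close>. Their products with \<open>z\<close> are related to elements of
      \<open>N\<close>, hence lie in \<open>L\<close>, and \<open>z\<close> cancels from the
      quotient.\<close>
    obtain z where z: "r (inv\<^bsub>G\<^esub> x') z"
      using total x by blast
    then have zc: "z \<in> carrier H" using carr by blast
    have "y \<otimes>\<^bsub>H\<^esub> z \<in> L"
      using null[OF mult[OF r(1) z]] 1 by simp
    moreover have "y' \<otimes>\<^bsub>H\<^esub> z \<in> L"
      using null[OF mult[OF r(2) z]] x subgroup.one_closed[OF N] by simp
    ultimately have "(y \<otimes>\<^bsub>H\<^esub> z) \<otimes>\<^bsub>H\<^esub> inv\<^bsub>H\<^esub> (y' \<otimes>\<^bsub>H\<^esub> z) \<in> L"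
      by simp
    moreover have "(y \<otimes>\<^bsub>H\<^esub> z) \<otimes>\<^bsub>H\<^esub> inv\<^bsub>H\<^esub> (y' \<otimes>\<^bsub>H\<^esub> z) = y \<otimes>\<^bsub>H\<^esub> inv\<^bsub>H\<^esub> y'"
      using y zc by (simp add: H.inv_mult_group H.m_assoc H.inv_solve_right') 
         (simp add: H.m_assoc[symmetric])
    ultimately have "y \<in> L #>\<^bsub>H\<^esub> y'"
      using subgroup.rcos_module_rev[OF L H.is_group y(2,1)] by simp
    then show ?thesis
      using H.repr_independence[OF _ y(2) L] by simp
  qed
  \<comment> \<open>The arbitrary choice does not affect \<open>f\<close>: by
    \<open>coset_eq\<close> every partner of \<open>x\<close> gives the same coset of
    \<open>L\<close>. Hence \<open>f\<close> is multiplicative although the chosen partners need not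
    be.\<close>
  define f where "f x = L #>\<^bsub>H\<^esub> (SOME y. r x y)" for x
  have f: "f x = L #>\<^bsub>H\<^esub> y" if "r x y" for x y
    unfolding f_def using that by (intro coset_eq[of x _ x]) (auto intro: someI)
  have "f \<in> hom G (H Mod L)"
  proof (rule homI)
    fix x assume "x \<in> carrier G"
    then obtain y where "r x y" using total by blast
    then show "f x \<in> carrier (H Mod L)"
      using f carr by (auto simp: carrier_FactGroup)
  next
    fix x x' assume "x \<in> carrier G" "x' \<in> carrier G"
    then obtain y y' where "r x y" "r x' y'" using total by blast
    then show "f (x \<otimes>\<^bsub>G\<^esub> x') = f x \<otimes>\<^bsub>H Mod L\<^esub> f x'"
      using f mult carr by (simp add: L.rcos_sum)
  qed
  moreover have "f x = f x'"
    if "x \<in> carrier G" "x' \<in> carrier G" "N #>\<^bsub>G\<^esub> x = N #>\<^bsub>G\<^esub> x'" for x x'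
    using that total f coset_eq by metis
  ultimately obtain h where h: "h \<in> hom (G Mod N) (H Mod L)"
    and "\<And>x. x \<in> carrier G \<Longrightarrow> h (N #>\<^bsub>G\<^esub> x) = f x"
    using FactGroup_universal[OF _ G.subgroup_imp_normal[OF N]] by metis
  then show thesis
    using that f carr by metis
qed

section \<open>Homology of a complex of abelian groups\<close>

locale comm_group_complex =
  fixes C :: "int \<Rightarrow> 'a monoid" and d :: "int \<Rightarrow> 'a \<Rightarrow> 'a"
  assumes comm_group: "comm_group (C k)"
    and d_hom: "d k \<in> hom (C k) (C (k - 1))"
    and d_d: "x \<in> carrier (C k) \<Longrightarrow> d (k - 1) (d k x) = \<one>\<^bsub>C (k - 2)\<^esub>"
begin

definition cycles :: "int \<Rightarrow> 'a monoid"
  where "cycles k = (C k)\<lparr>carrier := kernel (C k) (C (k - 1)) (d k)\<rparr>"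

definition bds :: "int \<Rightarrow> 'a set"
  where "bds k = d (k + 1) ` carrier (C (k + 1))"

text \<open>Phrased through \<open>homology_at\<close> so that \<open>Hom_homology\<close> unfolds
  to it literally. Arguments use the quotient form \<open>homol_eq\<close> instead.\<close>

definition homol :: "int \<Rightarrow> 'a set monoid"
  where "homol k = homology_at (C (k + 1)) (d (k + 1)) (C k) (d k) (C (k - 1))"

definition cls :: "int \<Rightarrow> 'a \<Rightarrow> 'a set"
  where "cls k x = bds k #>\<^bsub>cycles k\<^esub> x"

sublocale comm_group "C k" for k
  by (rule comm_group)

sublocale d: group_hom "C k" "C (k - 1)" "d k" for k
  by unfold_locales (rule d_hom)

lemma homol_eq: "homol k = cycles k Mod bds k"
  by (simp add: homol_def homology_at_def cycles_def bds_def)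

lemma cycles_iff: "x \<in> carrier (cycles k) \<longleftrightarrow> x \<in> carrier (C k) \<and> d k x = \<one>\<^bsub>C (k - 1)\<^esub>"
  by (simp add: cycles_def kernel_def)

lemma cycles_simps [simp]: "mult (cycles k) = mult (C k)" "\<one>\<^bsub>cycles k\<^esub> = \<one>\<^bsub>C k\<^esub>"
  by (simp_all add: cycles_def)

lemma comm_group_cycles: "comm_group (cycles k)"
  unfolding cycles_def
  by (rule group.group_comm_groupI[OF subgroup.subgroup_is_group[OF d.subgroup_kernel is_group]])
    (simp add: kernel_def m_comm)

lemma bds_iff: "x \<in> bds k \<longleftrightarrow> (\<exists>y\<in>carrier (C (k + 1)). x = d (k + 1) y)"
  by (auto simp: bds_def)

lemma d_in_cycles: "x \<in> carrier (C (k + 1)) \<Longrightarrow> d (k + 1) x \<in> carrier (cycles k)"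
  using d.hom_closed[of x "k + 1"] d_d[of x "k + 1"] by (simp add: cycles_iff)

lemma subgroup_bds: "subgroup (bds k) (cycles k)"
proof -
  have "subgroup (bds k) (C k)"
    using d.img_is_subgroup[of "k + 1"] by (simp add: bds_def)
  moreover have "bds k \<subseteq> kernel (C k) (C (k - 1)) (d k)"
    using d_in_cycles by (auto simp: bds_iff cycles_def)
  ultimately show ?thesis
    unfolding cycles_def by (rule subgroup_incl[OF _ d.subgroup_kernel])
qed

lemma carrier_homol: "carrier (homol k) = cls k ` carrier (cycles k)"
  by (simp add: homol_eq carrier_FactGroup cls_def)

lemma cls_eq_one_iff: "x \<in> carrier (cycles k) \<Longrightarrow> cls k x = \<one>\<^bsub>homol k\<^esub> \<longleftrightarrow> x \<in> bds k"
  using group.coset_join1[OF _ _ _ subgroup_bds] group.coset_join2[OF _ _ subgroup_bds]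
    comm_group.axioms(2)[OF comm_group_cycles]
  by (auto simp: homol_eq cls_def)

text \<open>Serves exactness at the middle homology, where a cycle is moved within its class into
  the image of \<open>i\<close>.\<close>

lemma cls_mult_bd:
  assumes "x \<in> carrier (cycles k)" "y \<in> carrier (C (k + 1))"
  shows "cls k (x \<otimes>\<^bsub>C k\<^esub> d (k + 1) y) = cls k x"
proof -
  interpret Z: comm_group "cycles k" by (rule comm_group_cycles)
  have "d (k + 1) y \<otimes>\<^bsub>C k\<^esub> x \<in> bds k #>\<^bsub>cycles k\<^esub> x"
    using assms(2) by (force simp: r_coset_def bds_iff)
  moreover have "x \<otimes>\<^bsub>C k\<^esub> d (k + 1) y = d (k + 1) y \<otimes>\<^bsub>C k\<^esub> x"
    using Z.m_comm[OF assms(1) d_in_cycles[OF assms(2)]] by simp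
  ultimately show ?thesis
    using Z.repr_independence[OF _ assms(1) subgroup_bds] by (simp add: cls_def)
qed

end

lemma homology_induced_hom:
  fixes A :: "int \<Rightarrow> 'a monoid" and B :: "int \<Rightarrow> 'b monoid" and k :: int
  assumes "comm_group_complex A dA" "comm_group_complex B dB"
    and hom: "\<And>k. f k \<in> hom (A k) (B k)"
    and comm: "\<And>k x. x \<in> carrier (A k) \<Longrightarrow> f (k - 1) (dA k x) = dB k (f k x)"
  shows "\<exists>h\<in>hom (comm_group_complex.homol A dA k) (comm_group_complex.homol B dB k).
    \<forall>x\<in>carrier (comm_group_complex.cycles A dA k).
      h (comm_group_complex.cls A dA k x) = comm_group_complex.cls B dB k (f k x)"
proof -
  interpret A: comm_group_complex A dA by fact
  interpret B: comm_group_complex B dB by fact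
  interpret f: group_hom "A l" "B l" "f l" for l
    by unfold_locales (rule hom)
  \<comment> \<open>The relation is the graph of \<open>f k\<close> on cycles. Commutation with the
    differentials keeps cycles cycles and boundaries boundaries.\<close>
  define r where "r x y \<longleftrightarrow> x \<in> carrier (A.cycles k) \<and> y = f k x" for x y
  have cyc: "f k x \<in> carrier (B.cycles k)" if "x \<in> carrier (A.cycles k)" for x
    using that comm[of x k] f.hom_closed[of x k] f.hom_one[of "k - 1"] by (simp add: A.cycles_iff B.cycles_iff)
  obtain h where h: "h \<in> hom (A.cycles k Mod A.bds k) (B.cycles k Mod B.bds k)"
    and h_cls: "\<And>x y. r x y \<Longrightarrow> h (A.bds k #>\<^bsub>A.cycles k\<^esub> x) = B.bds k #>\<^bsub>B.cycles k\<^esub> y"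
  proof (rule FactGroup_hom_of_relation[of "A.cycles k" "B.cycles k" "A.bds k" "B.bds k" r])
    show "y \<in> B.bds k" if "r x y" "x \<in> A.bds k" for x y
      using that comm[of _ "k + 1"] f.hom_closed[of _ "k + 1"] by (auto simp: r_def A.bds_iff B.bds_iff)
    show "r (x \<otimes>\<^bsub>A.cycles k\<^esub> x') (y \<otimes>\<^bsub>B.cycles k\<^esub> y')" if "r x y" "r x' y'" for x y x' y'
      using that comm_group.axioms(1)[OF A.comm_group_cycles, of k, THEN comm_monoid.axioms(1)]
        monoid.m_closed[of "A.cycles k" x x'] by (auto simp: r_def A.cycles_iff)
  qed (use A.comm_group_cycles B.comm_group_cycles A.subgroup_bds B.subgroup_bds cyc in \<open>auto simp: r_def\<close>)
  show ?thesis
    unfolding A.homol_eq B.homol_eq A.cls_def B.cls_def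
    by (intro bexI[OF _ h] ballI h_cls) (simp add: r_def)
qed

section \<open>The connecting homomorphism and the long exact sequence\<close>

locale short_exact_sequence_of_complexes =
  A: comm_group_complex A dA + B: comm_group_complex B dB + C: comm_group_complex C dC
  for A :: "int \<Rightarrow> 'a monoid" and dA and B :: "int \<Rightarrow> 'b monoid" and dB
    and C :: "int \<Rightarrow> 'c monoid" and dC +
  fixes i :: "int \<Rightarrow> 'a \<Rightarrow> 'b" and j :: "int \<Rightarrow> 'b \<Rightarrow> 'c"
  assumes i_hom: "i k \<in> hom (A k) (B k)"
    and i_d: "a \<in> carrier (A k) \<Longrightarrow> i (k - 1) (dA k a) = dB k (i k a)"
    and i_inj: "inj_on (i k) (carrier (A k))"
    and j_hom: "j k \<in> hom (B k) (C k)"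
    and j_d: "b \<in> carrier (B k) \<Longrightarrow> j (k - 1) (dB k b) = dC k (j k b)"
    and j_surj: "j k ` carrier (B k) = carrier (C k)"
    and exact: "i k ` carrier (A k) = kernel (B k) (C k) (j k)"
begin

sublocale i: group_hom "A k" "B k" "i k" for k
  by unfold_locales (rule i_hom)

sublocale j: group_hom "B k" "C k" "j k" for k
  by unfold_locales (rule j_hom)

lemma j_i: "a \<in> carrier (A k) \<Longrightarrow> j k (i k a) = \<one>\<^bsub>C k\<^esub>"
  using exact[of k] by (auto simp: kernel_def)

lemma j_eq_oneE:
  assumes "b \<in> carrier (B k)" "j k b = \<one>\<^bsub>C k\<^esub>"
  obtains a where "a \<in> carrier (A k)" "i k a = b"
proof -
  have "b \<in> i k ` carrier (A k)"
    using assms by (simp add: exact kernel_def)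
  then show thesis using that by blast
qed

lemma j_surjE:
  assumes "c \<in> carrier (C k)"
  obtains b where "b \<in> carrier (B k)" "j k b = c"
  using assms j_surj[of k] by (metis imageE)

lemma i_eqD: "i k a = i k a' \<Longrightarrow> a \<in> carrier (A k) \<Longrightarrow> a' \<in> carrier (A k) \<Longrightarrow> a = a'"
  using i_inj[of k] by (auto dest: inj_onD)

text \<open>Injectivity of \<open>i\<close> in degree \<open>k - 1\<close> reflects the vanishing of
  a boundary.\<close>

lemma cycle_if_i_cycle:
  assumes "a \<in> carrier (A k)" "dB k (i k a) = \<one>\<^bsub>B (k - 1)\<^esub>"
  shows "a \<in> carrier (A.cycles k)"
  using i_eqD[of "k - 1" "dA k a" "\<one>\<^bsub>A (k - 1)\<^esub>"] assms i_d[of a k]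
  by (simp add: A.cycles_iff A.d.hom_closed)

text \<open>The zigzag of the snake lemma, kept as a relation because the lift \<open>b\<close> of
  \<open>c\<close> is not unique. Only membership in \<open>A (k - 1)\<close> is asked of
  \<open>a\<close>; that \<open>a\<close> is a cycle follows in \<open>snake_cycle\<close> from the
  square of the differential of \<open>B\<close> being trivial.\<close>

definition snake :: "int \<Rightarrow> 'c \<Rightarrow> 'a \<Rightarrow> bool"
  where "snake k c a \<longleftrightarrow> c \<in> carrier (C.cycles k) \<and> a \<in> carrier (A (k - 1)) \<and>
    (\<exists>b\<in>carrier (B k). j k b = c \<and> i (k - 1) a = dB k b)"

lemma snake_cycle:
  assumes "snake k c a"
  shows "a \<in> carrier (A.cycles (k - 1))"
  using assms B.d_d[of _ k] by (intro cycle_if_i_cycle) (auto simp: snake_def)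

lemma snake_total:
  assumes "c \<in> carrier (C.cycles k)"
  shows "\<exists>a. snake k c a"
proof -
  obtain b where b: "b \<in> carrier (B k)" "j k b = c"
    using assms j_surjE by (auto simp: C.cycles_iff)
  then have "j (k - 1) (dB k b) = \<one>\<^bsub>C (k - 1)\<^esub>"
    using assms j_d[of b k] by (simp add: C.cycles_iff)
  then obtain a where "a \<in> carrier (A (k - 1))" "i (k - 1) a = dB k b"
    using j_eq_oneE[of "dB k b" "k - 1"] b(1) B.d.hom_closed by blast
  with b assms show ?thesis by (auto simp: snake_def)
qed

lemma snake_mult:
  assumes "snake k c a" "snake k c' a'"
  shows "snake k (c \<otimes>\<^bsub>C k\<^esub> c') (a \<otimes>\<^bsub>A (k - 1)\<^esub> a')"
proof -
  obtain b b' where b: "b \<in> carrier (B k)" "j k b = c" "i (k - 1) a = dB k b"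
    and b': "b' \<in> carrier (B k)" "j k b' = c'" "i (k - 1) a' = dB k b'"
    using assms by (auto simp: snake_def)
  have a: "a \<in> carrier (A (k - 1))" "a' \<in> carrier (A (k - 1))"
    using assms by (auto simp: snake_def)
  have "c \<otimes>\<^bsub>C k\<^esub> c' \<in> carrier (C.cycles k)"
    using assms by (auto simp: snake_def C.cycles_iff)
  moreover have "j k (b \<otimes>\<^bsub>B k\<^esub> b') = c \<otimes>\<^bsub>C k\<^esub> c'"
    using b b' by simp
  moreover have "i (k - 1) (a \<otimes>\<^bsub>A (k - 1)\<^esub> a') = dB k (b \<otimes>\<^bsub>B k\<^esub> b')"
    using a b b' by simp
  ultimately show ?thesis
    using a b(1) b'(1) by (auto simp: snake_def intro!: bexI[of _ "b \<otimes>\<^bsub>B k\<^esub> b'"])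
qed

text \<open>Independence of the connecting map from all choices comes down to this. If
  \<open>c\<close> is the boundary of \<open>c'\<close> and \<open>b'\<close> lifts
  \<open>c'\<close>, then \<open>b\<close> and the boundary of \<open>b'\<close> have the same image
  under \<open>j\<close>. Their quotient is \<open>i k a'\<close> for some \<open>a'\<close>, and
  comparing boundaries in \<open>B\<close> shows that \<open>a\<close> is the boundary of
  \<open>a'\<close>.\<close>

lemma snake_boundary:
  assumes "snake k c a" "c \<in> C.bds k"
  shows "a \<in> A.bds (k - 1)"
proof -
  obtain b where b: "b \<in> carrier (B k)" "j k b = c" "i (k - 1) a = dB k b"
    and a: "a \<in> carrier (A (k - 1))"
    using assms by (auto simp: snake_def)
  obtain c' where c': "c' \<in> carrier (C (k + 1))" "c = dC (k + 1) c'"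
    using assms by (auto simp: C.bds_iff)
  then obtain b' where b': "b' \<in> carrier (B (k + 1))" "j (k + 1) b' = c'"
    using j_surjE by blast
  have db': "dB (k + 1) b' \<in> carrier (B k)" "dB k (dB (k + 1) b') = \<one>\<^bsub>B (k - 1)\<^esub>"
    using B.d_in_cycles[OF b'(1)] by (auto simp: B.cycles_iff)
  have jd: "j k (dB (k + 1) b') = c"
    using j_d[OF b'(1)] b' c' by simp
  have "c \<in> carrier (C k)" using b by auto
  then have "j k (b \<otimes>\<^bsub>B k\<^esub> inv\<^bsub>B k\<^esub> dB (k + 1) b') = \<one>\<^bsub>C k\<^esub>"
    using b jd db' by simp
  then obtain a' where a': "a' \<in> carrier (A k)" "i k a' = b \<otimes>\<^bsub>B k\<^esub> inv\<^bsub>B k\<^esub> dB (k + 1) b'"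
    using j_eq_oneE[of _ k] b db' by (metis B.inv_closed B.m_closed)
  have "i (k - 1) (dA k a') = i (k - 1) a"
    using i_d[OF a'(1)] a'(2) b db' by simp
  then have "dA k a' = a"
    using i_eqD a a'(1) A.d.hom_closed by blast
  then show ?thesis
    using a' by (auto simp: A.bds_iff)
qed

lemma connecting_hom:
  "\<exists>\<delta>\<in>hom (C.homol k) (A.homol (k - 1)). \<forall>c a. snake k c a \<longrightarrow> \<delta> (C.cls k c) = A.cls (k - 1) a"
proof -
  obtain \<delta> where "\<delta> \<in> hom (C.cycles k Mod C.bds k) (A.cycles (k - 1) Mod A.bds (k - 1))"
    and "\<And>c a. snake k c a \<Longrightarrow>
      \<delta> (C.bds k #>\<^bsub>C.cycles k\<^esub> c) = A.bds (k - 1) #>\<^bsub>A.cycles (k - 1)\<^esub> a"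
  proof (rule FactGroup_hom_of_relation[of "C.cycles k" "A.cycles (k - 1)" "C.bds k" "A.bds (k - 1)"
        "snake k"])
    show "c \<in> carrier (C.cycles k) \<and> a \<in> carrier (A.cycles (k - 1))" if "snake k c a" for c a
      using that snake_cycle by (simp add: snake_def)
  qed (use A.comm_group_cycles C.comm_group_cycles A.subgroup_bds C.subgroup_bds
      snake_total snake_mult snake_boundary in auto)
  then show ?thesis
    unfolding A.homol_eq C.homol_eq A.cls_def C.cls_def by blast
qed

text \<open>Every class is represented by a cycle, so \<open>f_cls\<close>, \<open>g_cls\<close> and
  \<open>\<delta>_cls\<close> determine the maps and reduce the three equalities to diagram chases.
  For the kernels of \<open>g\<close> and \<open>\<delta>\<close> a representative is corrected, by
  a boundary in one case and by an element of the image of \<open>i\<close> in the other.\<close>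

theorem long_exact_homology_sequence:
  "\<exists>f g \<delta>. \<forall>k.
    f k \<in> hom (A.homol k) (B.homol k) \<and>
    g k \<in> hom (B.homol k) (C.homol k) \<and>
    \<delta> k \<in> hom (C.homol k) (A.homol (k - 1)) \<and>
    f k ` carrier (A.homol k) = kernel (B.homol k) (C.homol k) (g k) \<and>
    g k ` carrier (B.homol k) = kernel (C.homol k) (A.homol (k - 1)) (\<delta> k) \<and>
    \<delta> k ` carrier (C.homol k) = kernel (A.homol (k - 1)) (B.homol (k - 1)) (f (k - 1))"
proof -
  have "\<forall>k. \<exists>h. h \<in> hom (A.homol k) (B.homol k) \<and>
      (\<forall>x\<in>carrier (A.cycles k). h (A.cls k x) = B.cls k (i k x))"
    using homology_induced_hom[OF A.comm_group_complex_axioms B.comm_group_complex_axioms i_hom i_d]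
    by blast
  from choice[OF this] obtain f where f: "\<And>k. f k \<in> hom (A.homol k) (B.homol k)"
    and f_cls: "\<And>k x. x \<in> carrier (A.cycles k) \<Longrightarrow> f k (A.cls k x) = B.cls k (i k x)"
    by blast
  have "\<forall>k. \<exists>h. h \<in> hom (B.homol k) (C.homol k) \<and>
      (\<forall>x\<in>carrier (B.cycles k). h (B.cls k x) = C.cls k (j k x))"
    using homology_induced_hom[OF B.comm_group_complex_axioms C.comm_group_complex_axioms j_hom j_d]
    by blast
  from choice[OF this] obtain g where g: "\<And>k. g k \<in> hom (B.homol k) (C.homol k)"
    and g_cls: "\<And>k x. x \<in> carrier (B.cycles k) \<Longrightarrow> g k (B.cls k x) = C.cls k (j k x)"
    by blast
  have "\<forall>k. \<exists>h. h \<in> hom (C.homol k) (A.homol (k - 1)) \<and>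
      (\<forall>c a. snake k c a \<longrightarrow> h (C.cls k c) = A.cls (k - 1) a)"
    using connecting_hom by blast
  from choice[OF this] obtain \<delta> where \<delta>: "\<And>k. \<delta> k \<in> hom (C.homol k) (A.homol (k - 1))"
    and \<delta>_cls: "\<And>k c a. snake k c a \<Longrightarrow> \<delta> k (C.cls k c) = A.cls (k - 1) a"
    by blast
  have i_cycle: "i k a \<in> carrier (B.cycles k)" if "a \<in> carrier (A.cycles k)" for k a
    using that i_d[of a k] i.hom_one[of "k - 1"] by (simp add: A.cycles_iff B.cycles_iff)
  have j_cycle: "j k b \<in> carrier (C.cycles k)" if "b \<in> carrier (B.cycles k)" for k b
    using that j_d[of b k] j.hom_one[of "k - 1"] by (simp add: B.cycles_iff C.cycles_iff)
  have one_bds: "\<one>\<^bsub>A k\<^esub> \<in> A.bds k" "\<one>\<^bsub>C k\<^esub> \<in> C.bds k" for k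
    using subgroup.one_closed[OF A.subgroup_bds] subgroup.one_closed[OF C.subgroup_bds] by simp_all

  have exB: "f k ` carrier (A.homol k) = kernel (B.homol k) (C.homol k) (g k)" for k
  proof (intro equalityI subsetI)
    fix X assume "X \<in> f k ` carrier (A.homol k)"
    then obtain a where a: "a \<in> carrier (A.cycles k)" "X = B.cls k (i k a)"
      by (auto simp: A.carrier_homol f_cls)
    then have "g k X = C.cls k \<one>\<^bsub>C k\<^esub>"
      using j_i[of a k] by (simp add: g_cls i_cycle A.cycles_iff)
    also have "\<dots> = \<one>\<^bsub>C.homol k\<^esub>"
      using one_bds by (simp add: C.cls_eq_one_iff C.cycles_iff)
    finally show "X \<in> kernel (B.homol k) (C.homol k) (g k)"
      using a i_cycle by (auto simp: kernel_def B.carrier_homol)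
  next
    fix X assume "X \<in> kernel (B.homol k) (C.homol k) (g k)"
    then obtain b where b: "b \<in> carrier (B.cycles k)" "X = B.cls k b"
      and "C.cls k (j k b) = \<one>\<^bsub>C.homol k\<^esub>"
      by (auto simp: kernel_def B.carrier_homol g_cls)
    then obtain c where c: "c \<in> carrier (C (k + 1))" "j k b = dC (k + 1) c"
      using C.cls_eq_one_iff[OF j_cycle] by (auto simp: C.bds_iff)
    \<comment> \<open>With the inverse of \<open>c\<close> lifted, the boundary of \<open>b'\<close>
      is the required correction: its product with \<open>b\<close> is killed by \<open>j\<close>,
      hence comes from \<open>A\<close>, and still has the class of \<open>b\<close>.\<close>
    obtain b' where b': "b' \<in> carrier (B (k + 1))" "j (k + 1) b' = inv\<^bsub>C (k + 1)\<^esub> c"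
      using j_surjE c(1) C.inv_closed by metis
    have bk: "b \<in> carrier (B k)" "dB k b = \<one>\<^bsub>B (k - 1)\<^esub>" using b by (auto simp: B.cycles_iff)
    have db': "dB (k + 1) b' \<in> carrier (B k)" "dB k (dB (k + 1) b') = \<one>\<^bsub>B (k - 1)\<^esub>"
      using B.d_in_cycles[OF b'(1)] by (auto simp: B.cycles_iff)
    have "j k (dB (k + 1) b') = inv\<^bsub>C k\<^esub> (dC (k + 1) c)"
      using j_d[OF b'(1)] b' c C.d.hom_inv[of c "k + 1"] by simp
    then have "j k (b \<otimes>\<^bsub>B k\<^esub> dB (k + 1) b') = \<one>\<^bsub>C k\<^esub>"
      using bk db' c j.hom_closed[OF bk(1)] by (simp add: C.r_inv)
    then obtain a where a: "a \<in> carrier (A k)" "i k a = b \<otimes>\<^bsub>B k\<^esub> dB (k + 1) b'"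
      using j_eq_oneE[of _ k] bk db' by (metis B.m_closed)
    have "a \<in> carrier (A.cycles k)"
      using a bk db' by (intro cycle_if_i_cycle) simp_all
    moreover have "B.cls k (i k a) = X"
      using b B.cls_mult_bd b'(1) by (simp add: a(2))
    ultimately show "X \<in> f k ` carrier (A.homol k)"
      using f_cls by (auto simp: A.carrier_homol image_image image_iff intro!: bexI[of _ a])
  qed
  have exC: "g k ` carrier (B.homol k) = kernel (C.homol k) (A.homol (k - 1)) (\<delta> k)" for k
  proof (intro equalityI subsetI)
    fix X assume "X \<in> g k ` carrier (B.homol k)"
    then obtain b where b: "b \<in> carrier (B.cycles k)" "X = C.cls k (j k b)"
      by (auto simp: B.carrier_homol g_cls)
    \<comment> \<open>The cycle \<open>b\<close> serves as the lift of \<open>j k b\<close>. Its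
      boundary is trivial, so the unit of \<open>A (k - 1)\<close> completes the zigzag.\<close>
    then have "snake k (j k b) \<one>\<^bsub>A (k - 1)\<^esub>"
      using j_cycle i.hom_one[of "k - 1"] by (auto simp: snake_def B.cycles_iff)
    then have "\<delta> k X = \<one>\<^bsub>A.homol (k - 1)\<^esub>"
      using b \<delta>_cls snake_cycle one_bds by (simp add: A.cls_eq_one_iff)
    then show "X \<in> kernel (C.homol k) (A.homol (k - 1)) (\<delta> k)"
      using b j_cycle by (auto simp: kernel_def C.carrier_homol)
  next
    fix X assume "X \<in> kernel (C.homol k) (A.homol (k - 1)) (\<delta> k)"
    then obtain c where c: "c \<in> carrier (C.cycles k)" "X = C.cls k c"
      and one: "\<delta> k (C.cls k c) = \<one>\<^bsub>A.homol (k - 1)\<^esub>"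
      by (auto simp: kernel_def C.carrier_homol)
    obtain a where a: "snake k c a" using snake_total c by blast
    then obtain b where b: "b \<in> carrier (B k)" "j k b = c" "i (k - 1) a = dB k b"
      by (auto simp: snake_def)
    have "a \<in> A.bds (k - 1)"
      using one \<delta>_cls[OF a] A.cls_eq_one_iff[OF snake_cycle[OF a]] by simp
    then obtain a' where a': "a' \<in> carrier (A k)" "a = dA k a'"
      by (auto simp: A.bds_iff)
    \<comment> \<open>Since \<open>i k a'\<close> and \<open>b\<close> have the same boundary,
      dividing \<open>b\<close> by \<open>i k a'\<close> gives a cycle, and \<open>j\<close> does
      not notice the change.\<close>
    have da': "dB k (i k a') = dB k b"
      using i_d[OF a'(1)] a' b by simp
    have "b \<otimes>\<^bsub>B k\<^esub> inv\<^bsub>B k\<^esub> i k a' \<in> carrier (B.cycles k)"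
      using b a' da' B.d.hom_closed[OF b(1)] by (simp add: B.cycles_iff B.r_inv)
    moreover have "j k (b \<otimes>\<^bsub>B k\<^esub> inv\<^bsub>B k\<^esub> i k a') = c"
      using b a' j_i[OF a'(1)] c by (simp add: C.cycles_iff)
    ultimately show "X \<in> g k ` carrier (B.homol k)"
      using c g_cls by (auto simp: B.carrier_homol image_image image_iff
        intro!: bexI[of _ "b \<otimes>\<^bsub>B k\<^esub> inv\<^bsub>B k\<^esub> i k a'"])
  qed
  have exA: "\<delta> k ` carrier (C.homol k) = kernel (A.homol (k - 1)) (B.homol (k - 1)) (f (k - 1))" for k
  proof (intro equalityI subsetI)
    fix X assume "X \<in> \<delta> k ` carrier (C.homol k)"
    then obtain c where c: "c \<in> carrier (C.cycles k)" "X = \<delta> k (C.cls k c)"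
      by (auto simp: C.carrier_homol)
    obtain a where a: "snake k c a" using snake_total c by blast
    then obtain b where "b \<in> carrier (B k)" "i (k - 1) a = dB k b"
      by (auto simp: snake_def)
    then have "i (k - 1) a \<in> B.bds (k - 1)"
      by (auto simp: B.bds_iff)
    moreover have "X = A.cls (k - 1) a" using c \<delta>_cls[OF a] by simp
    ultimately show "X \<in> kernel (A.homol (k - 1)) (B.homol (k - 1)) (f (k - 1))"
      using snake_cycle[OF a] i_cycle
      by (auto simp: kernel_def f_cls B.cls_eq_one_iff A.carrier_homol)
  next
    fix X assume "X \<in> kernel (A.homol (k - 1)) (B.homol (k - 1)) (f (k - 1))"
    then obtain a where a: "a \<in> carrier (A.cycles (k - 1))" "X = A.cls (k - 1) a"
      and "B.cls (k - 1) (i (k - 1) a) = \<one>\<^bsub>B.homol (k - 1)\<^esub>"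
      by (auto simp: kernel_def A.carrier_homol f_cls)
    then obtain b where b: "b \<in> carrier (B k)" "i (k - 1) a = dB k b"
      using B.cls_eq_one_iff[OF i_cycle[OF a(1)]] by (auto simp: B.bds_iff)
    have ak: "a \<in> carrier (A (k - 1))" using a by (simp add: A.cycles_iff)
    \<comment> \<open>The boundary of \<open>j k b\<close> is the image under \<open>j\<close> of
      \<open>i (k - 1) a\<close>, hence trivial. The same \<open>b\<close> is then the lift in a
      zigzag from \<open>j k b\<close> to \<open>a\<close>.\<close>
    have "j k b \<in> carrier (C.cycles k)"
      using b j_d[OF b(1)] j_i[OF ak] by (simp add: C.cycles_iff)
    moreover from this have "snake k (j k b) a"
      using b ak by (auto simp: snake_def)
    ultimately show "X \<in> \<delta> k ` carrier (C.homol k)"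
      using a \<delta>_cls by (auto simp: C.carrier_homol image_image image_iff intro!: bexI[of _ "j k b"])
  qed
  show ?thesis
    by (intro exI[of _ f] exI[of _ g] exI[of _ \<delta>] allI conjI f g \<delta> exA exB exC)
qed

end


section \<open>The Hom complex\<close>

lemma lmod_homI:
  assumes "\<And>x. x \<in> carrier A \<Longrightarrow> f x \<in> carrier B"
    and "\<And>x y. x \<in> carrier A \<Longrightarrow> y \<in> carrier A \<Longrightarrow> f (x \<oplus>\<^bsub>A\<^esub> y) = f x \<oplus>\<^bsub>B\<^esub> f y"
    and "\<And>r x. r \<in> carrier R \<Longrightarrow> x \<in> carrier A \<Longrightarrow> f (r \<odot>\<^bsub>A\<^esub> x) = r \<odot>\<^bsub>B\<^esub> f x"
  shows "f \<in> lmod_hom R A B"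
  using assms by (auto simp: lmod_hom_def hom_def)

lemma lmod_homD:
  assumes "f \<in> lmod_hom R A B"
  shows lmod_hom_closed: "x \<in> carrier A \<Longrightarrow> f x \<in> carrier B"
    and lmod_hom_add: "x \<in> carrier A \<Longrightarrow> y \<in> carrier A \<Longrightarrow> f (x \<oplus>\<^bsub>A\<^esub> y) = f x \<oplus>\<^bsub>B\<^esub> f y"
    and lmod_hom_smult: "r \<in> carrier R \<Longrightarrow> x \<in> carrier A \<Longrightarrow> f (r \<odot>\<^bsub>A\<^esub> x) = r \<odot>\<^bsub>B\<^esub> f x"
  using assms by (auto simp: lmod_hom_def hom_def)

lemma lmod_hom_group_hom:
  assumes "left_module R A" "left_module R B" "f \<in> lmod_hom R A B"
  shows "abelian_group_hom A B f"
  using assms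
  by (intro abelian_group_homI) (auto simp: left_module_def group_hom_def group_hom_axioms_def
      abelian_group.a_group lmod_hom_def)

lemma lmod_hom_zero:
  assumes "left_module R A" "left_module R B" "f \<in> lmod_hom R A B"
  shows "f \<zero>\<^bsub>A\<^esub> = \<zero>\<^bsub>B\<^esub>"
  using abelian_group_hom.hom_zero[OF lmod_hom_group_hom[OF assms]] .

lemma lmod_hom_minus:
  assumes "left_module R A" "left_module R B" "f \<in> lmod_hom R A B" "x \<in> carrier A"
  shows "f (\<ominus>\<^bsub>A\<^esub> x) = \<ominus>\<^bsub>B\<^esub> f x"
  using abelian_group_hom.hom_a_inv[OF lmod_hom_group_hom[OF assms(1-3)] assms(4)] .

lemma lmod_hom_comp:
  "f \<in> lmod_hom R A B \<Longrightarrow> g \<in> lmod_hom R B C \<Longrightarrow> (\<lambda>x. g (f x)) \<in> lmod_hom R A C"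
  by (rule lmod_homI) (simp_all add: lmod_homD)

context left_module
begin

lemma smult_r_null:
  assumes "a \<in> carrier R"
  shows "a \<odot>\<^bsub>M\<^esub> \<zero>\<^bsub>M\<^esub> = \<zero>\<^bsub>M\<^esub>"
proof -
  have "a \<odot>\<^bsub>M\<^esub> \<zero>\<^bsub>M\<^esub> \<oplus>\<^bsub>M\<^esub> a \<odot>\<^bsub>M\<^esub> \<zero>\<^bsub>M\<^esub> = a \<odot>\<^bsub>M\<^esub> (\<zero>\<^bsub>M\<^esub> \<oplus>\<^bsub>M\<^esub> \<zero>\<^bsub>M\<^esub>)"
    using assms by (simp only: smult_r_distr M.zero_closed)
  then show ?thesis
    using assms M.add.r_cancel_one'[of "a \<odot>\<^bsub>M\<^esub> \<zero>\<^bsub>M\<^esub>" "a \<odot>\<^bsub>M\<^esub> \<zero>\<^bsub>M\<^esub>"] smult_closed by simp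
qed

lemma minus_null: "\<ominus>\<^bsub>M\<^esub> \<zero>\<^bsub>M\<^esub> = \<zero>\<^bsub>M\<^esub>"
  by (rule M.minus_equality) simp_all

lemma smult_minus:
  assumes "a \<in> carrier R" "x \<in> carrier M"
  shows "a \<odot>\<^bsub>M\<^esub> (\<ominus>\<^bsub>M\<^esub> x) = \<ominus>\<^bsub>M\<^esub> (a \<odot>\<^bsub>M\<^esub> x)"
proof (rule M.minus_equality[symmetric])
  show "a \<odot>\<^bsub>M\<^esub> (\<ominus>\<^bsub>M\<^esub> x) \<oplus>\<^bsub>M\<^esub> a \<odot>\<^bsub>M\<^esub> x = \<zero>\<^bsub>M\<^esub>"
    using assms by (simp add: smult_r_distr[symmetric] M.l_neg smult_r_null)
qed (use assms smult_closed in auto)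

lemma lmod_hom_const_zero: "(\<lambda>x. \<zero>\<^bsub>M\<^esub>) \<in> lmod_hom R A M"
  by (rule lmod_homI) (simp_all add: smult_r_null)

lemma lmod_hom_pointwise_add:
  assumes "f \<in> lmod_hom R A M" "g \<in> lmod_hom R A M"
  shows "(\<lambda>x. f x \<oplus>\<^bsub>M\<^esub> g x) \<in> lmod_hom R A M"
  using assms by (intro lmod_homI) (auto simp: lmod_homD[OF assms(1)] lmod_homD[OF assms(2)]
      smult_r_distr M.add.m_ac)

lemma lmod_hom_pointwise_minus:
  assumes "f \<in> lmod_hom R A M"
  shows "(\<lambda>x. \<ominus>\<^bsub>M\<^esub> f x) \<in> lmod_hom R A M"
  using assms by (intro lmod_homI) (auto simp: lmod_homD[OF assms] smult_minus M.minus_add)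

text \<open>Elements of \<open>Hom_grp\<close> are extensional, so every map has to be restricted
  before it can belong there. Linearity survives because the carrier is closed under the
  operations.\<close>

lemma lmod_hom_restrict:
  assumes "f \<in> lmod_hom R M B"
  shows "restrict f (carrier M) \<in> lmod_hom R M B"
  using assms by (intro lmod_homI) (auto simp: lmod_homD[OF assms] smult_closed)

end

section \<open>The groups of the Hom complex and their differential\<close>

lemma chain_complexD:
  assumes "chain_complex R X"
  shows chain_complex_module: "left_module R (cobj X n)"
    and chain_complex_diff: "cdiff X n \<in> lmod_hom R (cobj X n) (cobj X (n - 1))"
    and chain_complex_diff_diff:
      "x \<in> carrier (cobj X n) \<Longrightarrow> cdiff X (n - 1) (cdiff X n x) = \<zero>\<^bsub>cobj X (n - 2)\<^esub>"
  using assms by (auto simp: chain_complex_def)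

lemma Hom_grp_carrier_iff:
  "f \<in> carrier (Hom_grp R X Y n) \<longleftrightarrow>
    (\<forall>p. f p \<in> lmod_hom R (cobj X p) (cobj Y (p + n)) \<and> f p \<in> extensional (carrier (cobj X p)))"
  by (simp add: Hom_grp_def)

text \<open>The target degree is a variable with an equation because indices such as
  \<open>p - 1 + n\<close> and \<open>p + n - 1\<close> are equal but not syntactically so. Later
  closure rules use the same device.\<close>

lemma Hom_grp_lmod_hom:
  "f \<in> carrier (Hom_grp R X Y n) \<Longrightarrow> q = p + n \<Longrightarrow> f p \<in> lmod_hom R (cobj X p) (cobj Y q)"
  by (simp add: Hom_grp_carrier_iff)

lemma Hom_grp_eqI:
  assumes "f \<in> carrier (Hom_grp R X Y n)" "g \<in> carrier (Hom_grp R X Y n)"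
    and "\<And>p x. x \<in> carrier (cobj X p) \<Longrightarrow> f p x = g p x"
  shows "f = g"
proof (rule ext)
  fix p
  show "f p = g p"
    using assms by (intro extensionalityI[of _ "carrier (cobj X p)"]) (auto simp: Hom_grp_carrier_iff)
qed

lemma Hom_grp_mult: "(f \<otimes>\<^bsub>Hom_grp R X Y n\<^esub> g) p =
    (\<lambda>x\<in>carrier (cobj X p). f p x \<oplus>\<^bsub>cobj Y (p + n)\<^esub> g p x)"
  and Hom_grp_one: "\<one>\<^bsub>Hom_grp R X Y n\<^esub> p = (\<lambda>x\<in>carrier (cobj X p). \<zero>\<^bsub>cobj Y (p + n)\<^esub>)"
  by (simp_all add: Hom_grp_def)

locale hom_complex =
  fixes R :: "'r ring" and X :: "('r, 'a) complex_of_modules" and Y :: "('r, 'b) complex_of_modules"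
  assumes X: "chain_complex R X" and Y: "chain_complex R Y"
begin

sublocale X: left_module R "cobj X n" for n
  using X by (rule chain_complex_module)

sublocale Y: left_module R "cobj Y n" for n
  using Y by (rule chain_complex_module)

lemma Hom_grp_memI:
  assumes "\<And>p. f p \<in> lmod_hom R (cobj X p) (cobj Y (p + n))"
  shows "(\<lambda>p. restrict (f p) (carrier (cobj X p))) \<in> carrier (Hom_grp R X Y n)"
  using assms by (auto simp: Hom_grp_carrier_iff intro: X.lmod_hom_restrict)

lemma Hom_grp_closed:
  "f \<in> carrier (Hom_grp R X Y n) \<Longrightarrow> x \<in> carrier (cobj X p) \<Longrightarrow> q = p + n
    \<Longrightarrow> f p x \<in> carrier (cobj Y q)"
  using Hom_grp_lmod_hom lmod_hom_closed by metis

lemma comm_group_Hom_grp: "comm_group (Hom_grp R X Y n)"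
proof (rule comm_groupI)
  show closed: "f \<otimes>\<^bsub>Hom_grp R X Y n\<^esub> g \<in> carrier (Hom_grp R X Y n)"
    if "f \<in> carrier (Hom_grp R X Y n)" "g \<in> carrier (Hom_grp R X Y n)" for f g
    using Hom_grp_memI[of "\<lambda>p x. f p x \<oplus>\<^bsub>cobj Y (p + n)\<^esub> g p x" n,
        OF Y.lmod_hom_pointwise_add[OF Hom_grp_lmod_hom[OF that(1)] Hom_grp_lmod_hom[OF that(2)]]]
    by (simp add: Hom_grp_def)
  show one: "\<one>\<^bsub>Hom_grp R X Y n\<^esub> \<in> carrier (Hom_grp R X Y n)"
    using Hom_grp_memI[of "\<lambda>p x. \<zero>\<^bsub>cobj Y (p + n)\<^esub>" n, OF Y.lmod_hom_const_zero]
    by (simp add: Hom_grp_def)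
  note eqI = Hom_grp_eqI[of _ R X Y n]
  show "f \<otimes>\<^bsub>Hom_grp R X Y n\<^esub> g \<otimes>\<^bsub>Hom_grp R X Y n\<^esub> h = f \<otimes>\<^bsub>Hom_grp R X Y n\<^esub> (g \<otimes>\<^bsub>Hom_grp R X Y n\<^esub> h)"
    if "f \<in> carrier (Hom_grp R X Y n)" "g \<in> carrier (Hom_grp R X Y n)" "h \<in> carrier (Hom_grp R X Y n)"
    for f g h
    using that by (intro eqI closed) (simp_all add: Hom_grp_mult Hom_grp_closed Y.M.add.m_assoc)
  show "f \<otimes>\<^bsub>Hom_grp R X Y n\<^esub> g = g \<otimes>\<^bsub>Hom_grp R X Y n\<^esub> f"
    if "f \<in> carrier (Hom_grp R X Y n)" "g \<in> carrier (Hom_grp R X Y n)" for f g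
    using that by (intro eqI closed) (simp_all add: Hom_grp_mult Hom_grp_closed Y.M.add.m_comm)
  show "\<one>\<^bsub>Hom_grp R X Y n\<^esub> \<otimes>\<^bsub>Hom_grp R X Y n\<^esub> f = f" if "f \<in> carrier (Hom_grp R X Y n)" for f
    using that one by (intro eqI closed) (simp_all add: Hom_grp_mult Hom_grp_one Hom_grp_closed)
  show "\<exists>g\<in>carrier (Hom_grp R X Y n). g \<otimes>\<^bsub>Hom_grp R X Y n\<^esub> f = \<one>\<^bsub>Hom_grp R X Y n\<^esub>"
    if f: "f \<in> carrier (Hom_grp R X Y n)" for f
  proof
    let ?g = "\<lambda>p. \<lambda>x\<in>carrier (cobj X p). \<ominus>\<^bsub>cobj Y (p + n)\<^esub> f p x"
    show g: "?g \<in> carrier (Hom_grp R X Y n)"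
      using f by (intro Hom_grp_memI Y.lmod_hom_pointwise_minus Hom_grp_lmod_hom) auto
    show "?g \<otimes>\<^bsub>Hom_grp R X Y n\<^esub> f = \<one>\<^bsub>Hom_grp R X Y n\<^esub>"
      using f g one
      by (intro eqI closed) (simp_all add: Hom_grp_mult Hom_grp_one Hom_grp_closed Y.M.l_neg)
  qed
qed

text \<open>Subtraction is rewritten as addition of a negative, so that even and odd
  \<open>n\<close> share one formula and only the sign of the second summand depends on
  parity.\<close>

lemma Hom_diff_apply:
  "x \<in> carrier (cobj X p) \<Longrightarrow> Hom_diff X Y n f p x = cdiff Y (p + n) (f p x) \<oplus>\<^bsub>cobj Y (p + n - 1)\<^esub>
    (if even n then \<ominus>\<^bsub>cobj Y (p + n - 1)\<^esub> f (p - 1) (cdiff X p x) else f (p - 1) (cdiff X p x))"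
  by (simp add: Hom_diff_def a_minus_def Let_def)

lemma diff_X_closed: "x \<in> carrier (cobj X p) \<Longrightarrow> q = p - 1 \<Longrightarrow> cdiff X p x \<in> carrier (cobj X q)"
  using lmod_hom_closed[OF chain_complex_diff[OF X]] by simp

lemma diff_Y_closed: "y \<in> carrier (cobj Y p) \<Longrightarrow> q = p - 1 \<Longrightarrow> cdiff Y p y \<in> carrier (cobj Y q)"
  using lmod_hom_closed[OF chain_complex_diff[OF Y]] by simp

lemma Hom_diff_closed:
  assumes f: "f \<in> carrier (Hom_grp R X Y n)"
  shows "Hom_diff X Y n f \<in> carrier (Hom_grp R X Y (n - 1))"
proof -
  let ?D = "\<lambda>p x. cdiff Y (p + n) (f p x) \<oplus>\<^bsub>cobj Y (p + n - 1)\<^esub>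
    (if even n then \<ominus>\<^bsub>cobj Y (p + n - 1)\<^esub> f (p - 1) (cdiff X p x) else f (p - 1) (cdiff X p x))"
  have "?D p \<in> lmod_hom R (cobj X p) (cobj Y (p + (n - 1)))" for p
  proof -
    have a: "(\<lambda>x. cdiff Y (p + n) (f p x)) \<in> lmod_hom R (cobj X p) (cobj Y (p + n - 1))"
      by (rule lmod_hom_comp[OF Hom_grp_lmod_hom[OF f] chain_complex_diff[OF Y]]) simp
    have b: "(\<lambda>x. f (p - 1) (cdiff X p x)) \<in> lmod_hom R (cobj X p) (cobj Y (p + n - 1))"
      by (rule lmod_hom_comp[OF chain_complex_diff[OF X] Hom_grp_lmod_hom[OF f]]) simp
    have eq: "p + (n - 1) = p + n - 1" by simp
    show ?thesis
      unfolding eq using Y.lmod_hom_pointwise_add[OF a b]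
        Y.lmod_hom_pointwise_add[OF a Y.lmod_hom_pointwise_minus[OF b]] by (cases "even n") auto
  qed
  from Hom_grp_memI[of ?D, OF this] show ?thesis
    by (simp add: Hom_diff_def a_minus_def Let_def if_distrib cong: if_cong)
qed

lemma Hom_diff_hom: "Hom_diff X Y n \<in> hom (Hom_grp R X Y n) (Hom_grp R X Y (n - 1))"
proof (rule homI)
  fix f g assume f: "f \<in> carrier (Hom_grp R X Y n)" and g: "g \<in> carrier (Hom_grp R X Y n)"
  interpret H: comm_group "Hom_grp R X Y m" for m by (rule comm_group_Hom_grp)
  show "Hom_diff X Y n (f \<otimes>\<^bsub>Hom_grp R X Y n\<^esub> g) =
      Hom_diff X Y n f \<otimes>\<^bsub>Hom_grp R X Y (n - 1)\<^esub> Hom_diff X Y n g"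
  proof (rule Hom_grp_eqI[of _ R X Y "n - 1"])
    fix p x assume x: "x \<in> carrier (cobj X p)"
    have i: "p + (n - 1) = p + n - 1" "p - 1 + n = p + n - 1" by simp_all
    note closed = Hom_grp_closed[OF f] Hom_grp_closed[OF g] diff_X_closed diff_Y_closed
    show "Hom_diff X Y n (f \<otimes>\<^bsub>Hom_grp R X Y n\<^esub> g) p x =
        (Hom_diff X Y n f \<otimes>\<^bsub>Hom_grp R X Y (n - 1)\<^esub> Hom_diff X Y n g) p x"
      using x by (simp add: Hom_grp_mult Hom_diff_apply i closed Y.M.minus_add Y.M.add.m_ac
          lmod_hom_add[OF chain_complex_diff[OF Y]])
  qed (simp_all add: f g Hom_diff_closed)
qed (rule Hom_diff_closed)

text \<open>The two outer terms contain the square of a differential. The two mixed terms,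
  differential of \<open>Y\<close> after \<open>f\<close> after differential of \<open>X\<close>,
  carry opposite signs because \<open>n\<close> and \<open>n - 1\<close> differ in parity.\<close>

lemma Hom_diff_diff:
  assumes f: "f \<in> carrier (Hom_grp R X Y n)"
  shows "Hom_diff X Y (n - 1) (Hom_diff X Y n f) = \<one>\<^bsub>Hom_grp R X Y (n - 2)\<^esub>"
proof (rule Hom_grp_eqI[of _ R X Y "n - 2"])
  interpret H: comm_group "Hom_grp R X Y m" for m by (rule comm_group_Hom_grp)
  show "Hom_diff X Y (n - 1) (Hom_diff X Y n f) \<in> carrier (Hom_grp R X Y (n - 2))"
    using Hom_diff_closed[OF Hom_diff_closed[OF f]] by simp
  show "\<one>\<^bsub>Hom_grp R X Y (n - 2)\<^esub> \<in> carrier (Hom_grp R X Y (n - 2))" by simp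
  fix p x assume x: "x \<in> carrier (cobj X p)"
  have i: "p + (n - 1) = p + n - 1" "p - 1 + n = p + n - 1" "p + (n - 2) = p + n - 2"
    "p + n - 1 - 1 = p + n - 2" by simp_all
  note closed = Hom_grp_closed[OF f] diff_X_closed diff_Y_closed
  have "cdiff Y (p + n - 1) (cdiff Y (p + n) (f p x)) = \<zero>\<^bsub>cobj Y (p + n - 2)\<^esub>"
    using chain_complex_diff_diff[OF Y] closed x by simp
  moreover have "f (p - 2) (cdiff X (p - 1) (cdiff X p x)) = \<zero>\<^bsub>cobj Y (p + n - 2)\<^esub>"
    using chain_complex_diff_diff[OF X x] lmod_hom_zero[OF X.left_module_axioms Y.left_module_axioms
        Hom_grp_lmod_hom[OF f], of "p + n - 2" "p - 2"] by simp
  ultimately show "Hom_diff X Y (n - 1) (Hom_diff X Y n f) p x = \<one>\<^bsub>Hom_grp R X Y (n - 2)\<^esub> p x"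
    using x lmod_hom_add[OF chain_complex_diff[OF Y, of "p + n - 1"]]
      lmod_hom_minus[OF Y.left_module_axioms Y.left_module_axioms
        chain_complex_diff[OF Y, of "p + n - 1"]]
    by (simp add: Hom_grp_one Hom_diff_apply i closed Y.M.l_neg Y.M.r_neg Y.minus_null)
qed

text \<open>The offset \<open>l\<close> accounts for the shift of \<open>P\<close>: it is 1 for
  \<open>Hom(P, N)\<close> and 0 for the cone and \<open>G\<close>.\<close>

lemma comm_group_complex_Hom: "comm_group_complex (\<lambda>n. Hom_grp R X Y (n + l)) (\<lambda>n. Hom_diff X Y (n + l))"
proof (rule comm_group_complex.intro)
  show "comm_group (Hom_grp R X Y (k + l))" for k
    by (rule comm_group_Hom_grp)
  show "Hom_diff X Y (k + l) \<in> hom (Hom_grp R X Y (k + l)) (Hom_grp R X Y (k - 1 + l))" for k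
    using Hom_diff_hom[of "k + l"] by (simp add: algebra_simps)
  show "Hom_diff X Y (k - 1 + l) (Hom_diff X Y (k + l) f) = \<one>\<^bsub>Hom_grp R X Y (k - 2 + l)\<^esub>"
    if "f \<in> carrier (Hom_grp R X Y (k + l))" for k f
    using Hom_diff_diff[OF that] by (simp add: algebra_simps)
qed

end

section \<open>The mapping cone\<close>

lemma direct_sum_simps [simp]:
  "carrier (direct_sum A B) = carrier A \<times> carrier B"
  "\<zero>\<^bsub>direct_sum A B\<^esub> = (\<zero>\<^bsub>A\<^esub>, \<zero>\<^bsub>B\<^esub>)"
  "(a, b) \<oplus>\<^bsub>direct_sum A B\<^esub> (a', b') = (a \<oplus>\<^bsub>A\<^esub> a', b \<oplus>\<^bsub>B\<^esub> b')"
  "r \<odot>\<^bsub>direct_sum A B\<^esub> (a, b) = (r \<odot>\<^bsub>A\<^esub> a, r \<odot>\<^bsub>B\<^esub> b)"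
  by (simp_all add: direct_sum_def)

lemma left_module_direct_sum:
  assumes "left_module R A" "left_module R B"
  shows "left_module R (direct_sum A B)"
proof -
  interpret A: left_module R A by fact
  interpret B: left_module R B by fact
  have "abelian_group (direct_sum A B)"
  proof (rule abelian_groupI)
    show "\<exists>y\<in>carrier (direct_sum A B). y \<oplus>\<^bsub>direct_sum A B\<^esub> x = \<zero>\<^bsub>direct_sum A B\<^esub>"
      if "x \<in> carrier (direct_sum A B)" for x
      using that
      by (intro bexI[of _ "(\<ominus>\<^bsub>A\<^esub> fst x, \<ominus>\<^bsub>B\<^esub> snd x)"]) (auto simp: A.M.l_neg B.M.l_neg)
  qed (auto simp: A.M.add.m_ac B.M.add.m_ac)
  then show ?thesis
    by (intro left_module.intro left_module_axioms.intro)
      (auto simp: A.R.ring_axioms A.smult_closed B.smult_closed A.smult_l_distr B.smult_l_distr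
        A.smult_r_distr B.smult_r_distr A.smult_assoc1 B.smult_assoc1 A.smult_one B.smult_one)
qed

section \<open>The cone as a complex, and Hom out of it\<close>

locale mapping_cone_of_chain_map =
  fixes R :: "'r ring" and P :: "('r, 'b) complex_of_modules" and G :: "('r, 'a) complex_of_modules"
    and u :: "int \<Rightarrow> 'b \<Rightarrow> 'a"
  assumes P: "chain_complex R P" and G: "chain_complex R G" and u: "u \<in> chain_maps R P G"
begin

sublocale P: left_module R "cobj P n" for n
  using P by (rule chain_complex_module)

sublocale G: left_module R "cobj G n" for n
  using G by (rule chain_complex_module)

abbreviation cone where "cone \<equiv> mapping_cone P G u"

lemma cone_simps [simp]:
  "cobj cone n = direct_sum (cobj G n) (cobj P (n - 1))"
  "cdiff cone n (x, y) =
    (cdiff G n x \<oplus>\<^bsub>cobj G (n - 1)\<^esub> u (n - 1) y, \<ominus>\<^bsub>cobj P (n - 2)\<^esub> cdiff P (n - 1) y)"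
  by (simp_all add: mapping_cone_def)

lemma u_lmod_hom: "u n \<in> lmod_hom R (cobj P n) (cobj G n)"
  and u_diff: "y \<in> carrier (cobj P n) \<Longrightarrow> u (n - 1) (cdiff P n y) = cdiff G n (u n y)"
  using u by (auto simp: chain_maps_def)

lemma diff_P_closed: "y \<in> carrier (cobj P n) \<Longrightarrow> m = n - 1 \<Longrightarrow> cdiff P n y \<in> carrier (cobj P m)"
  using lmod_hom_closed[OF chain_complex_diff[OF P]] by simp

lemma diff_G_closed: "x \<in> carrier (cobj G n) \<Longrightarrow> m = n - 1 \<Longrightarrow> cdiff G n x \<in> carrier (cobj G m)"
  using lmod_hom_closed[OF chain_complex_diff[OF G]] by simp

text \<open>The mixed term of the squared differential is the boundary of \<open>u y\<close> plus
  \<open>u\<close> of the negated boundary of \<open>y\<close>. It vanishes since \<open>u\<close>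
  is a chain map, which explains the sign on the \<open>P\<close> part.\<close>

lemma chain_complex_cone: "chain_complex R cone"
  unfolding chain_complex_def
proof (intro allI conjI ballI)
  fix n
  show "left_module R (cobj cone n)"
    by (simp add: left_module_direct_sum[OF G.left_module_axioms P.left_module_axioms])
  have dP: "cdiff P (n - 1) \<in> lmod_hom R (cobj P (n - 1)) (cobj P (n - 2))"
    using chain_complex_diff[OF P, of "n - 1"] by simp
  note closed = diff_P_closed diff_G_closed lmod_hom_closed[OF u_lmod_hom]
  show "cdiff cone n \<in> lmod_hom R (cobj cone n) (cobj cone (n - 1))"
    by (rule lmod_homI)
      (auto simp: closed lmod_hom_add[OF dP] lmod_hom_smult[OF dP] lmod_hom_add[OF u_lmod_hom]
        lmod_hom_smult[OF u_lmod_hom] lmod_hom_add[OF chain_complex_diff[OF G]]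
        lmod_hom_smult[OF chain_complex_diff[OF G]] G.M.add.m_ac P.M.minus_add G.smult_r_distr
        P.smult_minus)
  fix z assume "z \<in> carrier (cobj cone n)"
  then obtain x y where z: "z = (x, y)" and x: "x \<in> carrier (cobj G n)"
    and y: "y \<in> carrier (cobj P (n - 1))" by auto
  have "cdiff G (n - 1) (cdiff G n x \<oplus>\<^bsub>cobj G (n - 1)\<^esub> u (n - 1) y)
      \<oplus>\<^bsub>cobj G (n - 2)\<^esub> u (n - 2) (\<ominus>\<^bsub>cobj P (n - 2)\<^esub> cdiff P (n - 1) y) = \<zero>\<^bsub>cobj G (n - 2)\<^esub>"
    using x y chain_complex_diff_diff[OF G x] u_diff[OF y]
      lmod_hom_add[OF chain_complex_diff[OF G, of "n - 1"]]
      lmod_hom_minus[OF P.left_module_axioms G.left_module_axioms u_lmod_hom[of "n - 2"]]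
    by (simp add: closed G.M.r_neg)
  moreover have "\<ominus>\<^bsub>cobj P (n - 3)\<^esub> cdiff P (n - 2) (\<ominus>\<^bsub>cobj P (n - 2)\<^esub> cdiff P (n - 1) y) = \<zero>\<^bsub>cobj P (n - 3)\<^esub>"
    using y chain_complex_diff_diff[OF P y]
      lmod_hom_minus[OF P.left_module_axioms P.left_module_axioms chain_complex_diff[OF P, of "n - 2"]]
    by (simp add: closed P.minus_null)
  ultimately show "cdiff cone (n - 1) (cdiff cone n z) = \<zero>\<^bsub>cobj cone (n - 2)\<^esub>"
    using z by simp
qed

lemma lmod_hom_inj: "(\<lambda>x. (x, \<zero>\<^bsub>cobj P (n - 1)\<^esub>)) \<in> lmod_hom R (cobj G n) (cobj cone n)"
  by (rule lmod_homI) (simp_all add: P.smult_r_null)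

lemma lmod_hom_snd: "snd \<in> lmod_hom R (cobj cone n) (cobj P (n - 1))"
  by (rule lmod_homI) auto

text \<open>Precomposition with the inclusion of \<open>G\<close> into the cone.\<close>

definition restrict_to_target ::
    "(int \<Rightarrow> 'a \<times> 'b \<Rightarrow> 'c) \<Rightarrow> int \<Rightarrow> 'a \<Rightarrow> 'c"
  where "restrict_to_target h = (\<lambda>p. \<lambda>x\<in>carrier (cobj G p). h p (x, \<zero>\<^bsub>cobj P (p - 1)\<^esub>))"

text \<open>Precomposition with the projection onto the shifted \<open>P\<close>. A family of degree
  \<open>k + 1\<close> on \<open>P\<close> becomes one of degree \<open>k\<close> on the cone,
  because \<open>p - 1 + (k + 1) = p + k\<close>.\<close>

definition pull_back_to_cone ::
    "(int \<Rightarrow> 'b \<Rightarrow> 'c) \<Rightarrow> int \<Rightarrow> 'a \<times> 'b \<Rightarrow> 'c"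
  where "pull_back_to_cone b = (\<lambda>p. \<lambda>z\<in>carrier (cobj cone p). b (p - 1) (snd z))"

text \<open>The signs in the differentials of the shift and of the cone cancel, so \<open>Hom(P[-1], N)\<close>
  is \<open>Hom(P, N)\<close> with degrees shifted and unchanged differential.\<close>

lemma short_exact_sequence_Hom_cone:
  fixes N :: "('r, 'c) complex_of_modules"
  assumes N: "chain_complex R N"
  shows "short_exact_sequence_of_complexes
    (\<lambda>k. Hom_grp R P N (k + 1)) (\<lambda>k. Hom_diff P N (k + 1))
    (Hom_grp R cone N) (Hom_diff cone N) (Hom_grp R G N) (Hom_diff G N)
    (\<lambda>k. pull_back_to_cone) (\<lambda>k. restrict_to_target)"
proof -
  interpret hP: hom_complex R P N using P N by (rule hom_complex.intro)
  interpret hG: hom_complex R G N using G N by (rule hom_complex.intro)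
  interpret hC: hom_complex R cone N using chain_complex_cone N by (rule hom_complex.intro)
  interpret HP: comm_group_complex "\<lambda>k. Hom_grp R P N (k + 1)" "\<lambda>k. Hom_diff P N (k + 1)"
    by (rule hP.comm_group_complex_Hom)
  interpret HG: comm_group_complex "Hom_grp R G N" "Hom_diff G N"
    using hG.comm_group_complex_Hom[of 0] by simp
  interpret HC: comm_group_complex "Hom_grp R cone N" "Hom_diff cone N"
    using hC.comm_group_complex_Hom[of 0] by simp
  note closed = diff_P_closed diff_G_closed lmod_hom_closed[OF u_lmod_hom] hP.diff_Y_closed
    hP.Hom_grp_closed hG.Hom_grp_closed hC.Hom_grp_closed
  have pull_closed: "pull_back_to_cone b \<in> carrier (Hom_grp R cone N k)"
    if b: "b \<in> carrier (Hom_grp R P N (k + 1))" for b k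
    unfolding pull_back_to_cone_def
    by (rule hC.Hom_grp_memI, rule lmod_hom_comp[OF lmod_hom_snd Hom_grp_lmod_hom[OF b]]) simp
  have res_closed: "restrict_to_target h \<in> carrier (Hom_grp R G N k)"
    if h: "h \<in> carrier (Hom_grp R cone N k)" for h k
    unfolding restrict_to_target_def
    by (rule hG.Hom_grp_memI, rule lmod_hom_comp[OF lmod_hom_inj Hom_grp_lmod_hom[OF h]]) simp
  have pull: "pull_back_to_cone b p (x, y) = b (p - 1) y"
    if "x \<in> carrier (cobj G p)" "y \<in> carrier (cobj P (p - 1))" for b p x y
    using that by (simp add: pull_back_to_cone_def)
  have res: "restrict_to_target h p x = h p (x, \<zero>\<^bsub>cobj P (p - 1)\<^esub>)"
    if "x \<in> carrier (cobj G p)" for h p x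
    using that by (simp add: restrict_to_target_def)
  \<comment> \<open>A family on the cone is determined by its values on the two summands. This is
    how a member of the kernel is recovered from its part on \<open>P\<close>.\<close>
  have split: "h p (x, y) = h p (x, \<zero>\<^bsub>cobj P (p - 1)\<^esub>) \<oplus>\<^bsub>cobj N (p + k)\<^esub> h p (\<zero>\<^bsub>cobj G p\<^esub>, y)"
    if "h \<in> carrier (Hom_grp R cone N k)" "x \<in> carrier (cobj G p)" "y \<in> carrier (cobj P (p - 1))"
    for h p k x y
    using lmod_hom_add[OF Hom_grp_lmod_hom[OF that(1) refl],
        of "(x, \<zero>\<^bsub>cobj P (p - 1)\<^esub>)" p "(\<zero>\<^bsub>cobj G p\<^esub>, y)"] that by simp
  show ?thesis
  proof (intro short_exact_sequence_of_complexes.intro short_exact_sequence_of_complexes_axioms.intro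
      HP.comm_group_complex_axioms HG.comm_group_complex_axioms HC.comm_group_complex_axioms)
    fix k
    show "pull_back_to_cone \<in> hom (Hom_grp R P N (k + 1)) (Hom_grp R cone N k)"
    proof (rule homI)
      fix b c assume b: "b \<in> carrier (Hom_grp R P N (k + 1))" and c: "c \<in> carrier (Hom_grp R P N (k + 1))"
      show "pull_back_to_cone (b \<otimes>\<^bsub>Hom_grp R P N (k + 1)\<^esub> c) =
          pull_back_to_cone b \<otimes>\<^bsub>Hom_grp R cone N k\<^esub> pull_back_to_cone c"
        using b c
        by (intro Hom_grp_eqI[of _ R cone N k] pull_closed HP.m_closed HC.m_closed)
          (auto simp: Hom_grp_mult pull)
    qed (rule pull_closed)
    show "restrict_to_target \<in> hom (Hom_grp R cone N k) (Hom_grp R G N k)"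
    proof (rule homI)
      fix h h' assume h: "h \<in> carrier (Hom_grp R cone N k)" and h': "h' \<in> carrier (Hom_grp R cone N k)"
      show "restrict_to_target (h \<otimes>\<^bsub>Hom_grp R cone N k\<^esub> h') =
          restrict_to_target h \<otimes>\<^bsub>Hom_grp R G N k\<^esub> restrict_to_target h'"
        using h h'
        by (intro Hom_grp_eqI[of _ R G N k] res_closed HG.m_closed HC.m_closed)
          (auto simp: Hom_grp_mult res)
    qed (rule res_closed)
    show "pull_back_to_cone (Hom_diff P N (k + 1) b) = Hom_diff cone N k (pull_back_to_cone b)"
      if b: "b \<in> carrier (Hom_grp R P N (k + 1))" for b
    proof (rule Hom_grp_eqI[of _ R cone N "k - 1"])
      show "pull_back_to_cone (Hom_diff P N (k + 1) b) \<in> carrier (Hom_grp R cone N (k - 1))"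
        using hP.Hom_diff_closed[OF b] by (intro pull_closed) simp
      show "Hom_diff cone N k (pull_back_to_cone b) \<in> carrier (Hom_grp R cone N (k - 1))"
        by (intro hC.Hom_diff_closed pull_closed b)
      fix p z assume "z \<in> carrier (cobj cone p)"
      then obtain x y where z: "z = (x, y)" and x: "x \<in> carrier (cobj G p)"
        and y: "y \<in> carrier (cobj P (p - 1))" by auto
      have i: "p - 1 + (k + 1) = p + k" "p - 1 + k = p + k - 1" by simp_all
      \<comment> \<open>The pulled back \<open>b\<close> sees only the second component of the cone
        differential. Taking its minus sign out of \<open>b\<close> makes up for the change of
        parity from \<open>k\<close> to \<open>k + 1\<close>.\<close>
      have "b (p - 2) (\<ominus>\<^bsub>cobj P (p - 2)\<^esub> cdiff P (p - 1) y) =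
          \<ominus>\<^bsub>cobj N (p + k - 1)\<^esub> b (p - 2) (cdiff P (p - 1) y)"
        using lmod_hom_minus[OF P.left_module_axioms hP.Y.left_module_axioms
            Hom_grp_lmod_hom[OF b, of "p + k - 1" "p - 2"]] y by (simp add: closed)
      then show "pull_back_to_cone (Hom_diff P N (k + 1) b) p z =
          Hom_diff cone N k (pull_back_to_cone b) p z"
        using x y b by (simp add: z pull hP.Hom_diff_apply hC.Hom_diff_apply closed i)
    qed
    show "restrict_to_target (Hom_diff cone N k h) = Hom_diff G N k (restrict_to_target h)"
      if h: "h \<in> carrier (Hom_grp R cone N k)" for h
    proof (rule Hom_grp_eqI[of _ R G N "k - 1"])
      show "restrict_to_target (Hom_diff cone N k h) \<in> carrier (Hom_grp R G N (k - 1))"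
        by (intro hC.Hom_diff_closed res_closed h)
      show "Hom_diff G N k (restrict_to_target h) \<in> carrier (Hom_grp R G N (k - 1))"
        by (intro hG.Hom_diff_closed res_closed h)
      fix p x assume x: "x \<in> carrier (cobj G p)"
      \<comment> \<open>At elements with second component zero, \<open>u\<close> contributes nothing
        and the cone differential is that of \<open>G\<close>.\<close>
      have "u (p - 1) \<zero>\<^bsub>cobj P (p - 1)\<^esub> = \<zero>\<^bsub>cobj G (p - 1)\<^esub>"
        using lmod_hom_zero[OF P.left_module_axioms G.left_module_axioms u_lmod_hom] .
      moreover have "cdiff P (p - 1) \<zero>\<^bsub>cobj P (p - 1)\<^esub> = \<zero>\<^bsub>cobj P (p - 2)\<^esub>"
        using lmod_hom_zero[OF P.left_module_axioms P.left_module_axioms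
            chain_complex_diff[OF P, of "p - 1"]] by simp
      ultimately show "restrict_to_target (Hom_diff cone N k h) p x =
          Hom_diff G N k (restrict_to_target h) p x"
        using x h by (simp add: res hG.Hom_diff_apply hC.Hom_diff_apply closed P.minus_null)
    qed
    show "inj_on pull_back_to_cone (carrier (Hom_grp R P N (k + 1)))"
    proof (rule inj_onI)
      fix b c assume b: "b \<in> carrier (Hom_grp R P N (k + 1))" and c: "c \<in> carrier (Hom_grp R P N (k + 1))"
        and eq: "pull_back_to_cone b = pull_back_to_cone c"
      show "b = c"
      proof (rule Hom_grp_eqI[OF b c])
        fix p y assume "y \<in> carrier (cobj P p)"
        \<comment> \<open>\<open>pull_back_to_cone\<close> lowers the index, so the value of
          \<open>b\<close> in degree \<open>p\<close> is read off in degree \<open>p + 1\<close>, at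
          an element whose first component is zero.\<close>
        then show "b p y = c p y"
          using pull[of "\<zero>\<^bsub>cobj G (p + 1)\<^esub>" "p + 1" y b] pull[of "\<zero>\<^bsub>cobj G (p + 1)\<^esub>" "p + 1" y c] eq
          by simp
      qed
    qed
    show "restrict_to_target ` carrier (Hom_grp R cone N k) = carrier (Hom_grp R G N k)"
    proof (intro equalityI subsetI)
      fix a assume a: "a \<in> carrier (Hom_grp R G N k)"
      \<comment> \<open>Extension by zero on the \<open>P\<close> summand. The projection
        \<open>fst\<close> is linear in each degree but in general not a chain map, so
        \<open>?h\<close> need not be a cycle when \<open>a\<close> is one.\<close>
      let ?h = "\<lambda>p. \<lambda>z\<in>carrier (cobj cone p). a p (fst z)"
      have "fst \<in> lmod_hom R (cobj cone p) (cobj G p)" for p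
        by (rule lmod_homI) auto
      then have h: "?h \<in> carrier (Hom_grp R cone N k)"
        by (intro hC.Hom_grp_memI lmod_hom_comp[OF _ Hom_grp_lmod_hom[OF a]]) simp_all
      have "a = restrict_to_target ?h"
        by (rule Hom_grp_eqI[OF a res_closed[OF h]]) (simp add: res)
      then show "a \<in> restrict_to_target ` carrier (Hom_grp R cone N k)"
        using h by blast
    qed (use res_closed in auto)
    show "pull_back_to_cone ` carrier (Hom_grp R P N (k + 1)) =
        kernel (Hom_grp R cone N k) (Hom_grp R G N k) restrict_to_target"
    proof (intro equalityI subsetI)
      fix h assume "h \<in> pull_back_to_cone ` carrier (Hom_grp R P N (k + 1))"
      then obtain b where b: "b \<in> carrier (Hom_grp R P N (k + 1))" and h: "h = pull_back_to_cone b"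
        by blast
      have "b (p - 1) \<zero>\<^bsub>cobj P (p - 1)\<^esub> = \<zero>\<^bsub>cobj N (p + k)\<^esub>" for p
        using lmod_hom_zero[OF P.left_module_axioms hP.Y.left_module_axioms
            Hom_grp_lmod_hom[OF b, of "p + k" "p - 1"]] by simp
      then have "restrict_to_target h = \<one>\<^bsub>Hom_grp R G N k\<^esub>"
        unfolding h using b
        by (intro Hom_grp_eqI[of _ R G N k] res_closed pull_closed HG.one_closed)
          (auto simp: res pull Hom_grp_one)
      then show "h \<in> kernel (Hom_grp R cone N k) (Hom_grp R G N k) restrict_to_target"
        using pull_closed[OF b] by (simp add: kernel_def h)
    next
      fix h assume "h \<in> kernel (Hom_grp R cone N k) (Hom_grp R G N k) restrict_to_target"
      then have h: "h \<in> carrier (Hom_grp R cone N k)"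
        and one: "restrict_to_target h = \<one>\<^bsub>Hom_grp R G N k\<^esub>"
        by (auto simp: kernel_def)
      have zero: "h p (x, \<zero>\<^bsub>cobj P (p - 1)\<^esub>) = \<zero>\<^bsub>cobj N (p + k)\<^esub>" if "x \<in> carrier (cobj G p)" for p x
        using res[OF that, of h] that by (simp add: one Hom_grp_one)
      \<comment> \<open>As \<open>h\<close> vanishes on \<open>G\<close>, it is governed by its
        values at pairs with first component zero; the index \<open>p + 1\<close> undoes the shift
        in \<open>pull_back_to_cone\<close>.\<close>
      let ?b = "\<lambda>p. \<lambda>y\<in>carrier (cobj P p). h (p + 1) (\<zero>\<^bsub>cobj G (p + 1)\<^esub>, y)"
      have "(\<lambda>y. (\<zero>\<^bsub>cobj G (p + 1)\<^esub>, y)) \<in> lmod_hom R (cobj P p) (cobj cone (p + 1))" for p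
        by (rule lmod_homI) (simp_all add: G.smult_r_null)
      then have b: "?b \<in> carrier (Hom_grp R P N (k + 1))"
        by (intro hP.Hom_grp_memI lmod_hom_comp[OF _ Hom_grp_lmod_hom[OF h]]) simp_all
      have "h = pull_back_to_cone ?b"
      proof (rule Hom_grp_eqI[OF h pull_closed[OF b]])
        fix p z assume "z \<in> carrier (cobj cone p)"
        then obtain x y where z: "z = (x, y)" and x: "x \<in> carrier (cobj G p)"
          and y: "y \<in> carrier (cobj P (p - 1))" by auto
        then show "h p z = pull_back_to_cone ?b p z"
          using split[OF h x y] by (simp add: pull zero hC.Hom_grp_closed[OF h])
      qed
      then show "h \<in> pull_back_to_cone ` carrier (Hom_grp R P N (k + 1))"
        using b by blast
    qed
  qed
qed

end

section \<open>Translation to cohomological degrees\<close>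

theorem proposition9:
  fixes R :: "'r ring"
    and M P G N :: "('r, 'm) complex_of_modules"
    and \<pi> \<phi> u :: "int \<Rightarrow> 'm \<Rightarrow> 'm"
  assumes "infinite (UNIV :: 'm set)"
    and "carrier R \<lesssim> (UNIV :: 'm set)"
    and "gorenstein_ring R"
    and "chain_complex R M"
    and "resolution_data R M P \<pi> G \<phi> u"
    and "chain_complex R N"
  shows "\<exists>\<alpha> \<beta> \<gamma>. \<forall>n :: int.
      \<alpha> n \<in> hom (Ext_abs R P n N) (Ext_tate R P G u n N) \<and>
      \<beta> n \<in> hom (Ext_tate R P G u n N) (Ext_gor R G (n + 1) N) \<and>
      \<gamma> n \<in> hom (Ext_gor R G n N) (Ext_abs R P n N) \<and>
      \<gamma> n ` carrier (Ext_gor R G n N) = kernel (Ext_abs R P n N) (Ext_tate R P G u n N) (\<alpha> n) \<and>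
      \<alpha> n ` carrier (Ext_abs R P n N) = kernel (Ext_tate R P G u n N) (Ext_gor R G (n + 1) N) (\<beta> n) \<and>
      \<beta> n ` carrier (Ext_tate R P G u n N) = kernel (Ext_gor R G (n + 1) N) (Ext_abs R P (n + 1) N) (\<gamma> (n + 1))"
proof -
  have "chain_complex R P" "chain_complex R G" "u \<in> chain_maps R P G"
    using assms(5) by (auto simp: resolution_data_def DG_projective_resolution_def DG_projective_def
        special_gorenstein_projective_precover_def gorenstein_projective_precover_def
        gorenstein_projective_def)
  then interpret mapping_cone_of_chain_map R P G u
    by (rule mapping_cone_of_chain_map.intro)
  interpret S: short_exact_sequence_of_complexes
    "\<lambda>k. Hom_grp R P N (k + 1)" "\<lambda>k. Hom_diff P N (k + 1)"
    "Hom_grp R cone N" "Hom_diff cone N" "Hom_grp R G N" "Hom_diff G N"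
    "\<lambda>k. pull_back_to_cone" "\<lambda>k. restrict_to_target"
    using assms(6) by (rule short_exact_sequence_Hom_cone)
  have homol: "S.A.homol k = Hom_homology R P N (k + 1)" "S.B.homol k = Hom_homology R cone N k"
    "S.C.homol k = Hom_homology R G N k" for k
    by (simp_all add: S.A.homol_def S.B.homol_def S.C.homol_def Hom_homology_def)
  obtain f g \<delta> where les: "\<And>k. f k \<in> hom (S.A.homol k) (S.B.homol k) \<and>
      g k \<in> hom (S.B.homol k) (S.C.homol k) \<and>
      \<delta> k \<in> hom (S.C.homol k) (S.A.homol (k - 1)) \<and>
      f k ` carrier (S.A.homol k) = kernel (S.B.homol k) (S.C.homol k) (g k) \<and>
      g k ` carrier (S.B.homol k) = kernel (S.C.homol k) (S.A.homol (k - 1)) (\<delta> k) \<and>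
      \<delta> k ` carrier (S.C.homol k) = kernel (S.A.homol (k - 1)) (S.B.homol (k - 1)) (f (k - 1))"
    using S.long_exact_homology_sequence by metis
  \<comment> \<open>The homology of the shifted \<open>P\<close> at \<open>k - 1\<close> appears in
    degree \<open>k - 1 + 1\<close>; cancelling yields \<open>Hom_homology R P N k\<close>.\<close>
  note les = les[unfolded homol diff_add_cancel]
  have deg: "- (n + 1) = - n - 1" for n :: int by simp
  show ?thesis
    unfolding Ext_abs_def Ext_gor_def Ext_tate_def Hom_cohomology_def
    \<comment> \<open>Cohomological degree \<open>n\<close> is homological degree
      \<open>- n\<close>. At \<open>k = - n - 1\<close> the sequence runs from absolute cohomology
      in degree \<open>n\<close> through Tate cohomology in degree \<open>n\<close> to Gorenstein
      cohomology in degree \<open>n + 1\<close>. The connecting map out of Gorenstein cohomology in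
      degree \<open>n\<close> sits at \<open>k = - n\<close>, so two consecutive instances of
      \<open>les\<close> are combined.\<close>
    apply (intro exI[of _ "\<lambda>n. f (- n - 1)"] exI[of _ "\<lambda>n. g (- n - 1)"] exI[of _ "\<lambda>n. \<delta> (- n)"] allI)
    subgoal for n
      using les[of "- n"] les[of "- n - 1"] unfolding diff_add_cancel deg
      by (elim conjE) (intro conjI; assumption)
    done
qed

end
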